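(* Let $\mathcal P$ be a monotone graph property, let $\theta>0$, and let the restriction set be $\mathcal R=\{G_{\boldsymbol w}:\operatorname{maxdeg}(G)\le s,\ \|\boldsymbol w\|_\infty\le\Theta/\theta\}$. Then: (i) If $s\ge3$, then $$\mathcal Q(\mathcal P,\mathcal R,\theta)\le\frac{R(s,\Theta)-1}{R(s,\Theta)+1},\qquad R(s,\Theta)=\frac{\cosh(2s\Theta)+2se^{-2(s-1)\Theta}\cosh(2(s-1)\Theta)}{2se^{-2(s-1)\Theta}\cosh(2\Theta)+1}.$$ (ii) If $(s-1)\tanh(\Theta)<1$, then $$\mathcal Q(\mathcal P,\mathcal R,\theta)\le\frac{s\tanh^2(\Theta)}{1-(s-1)\tanh(\Theta)}.$$
   Context: Graphs are simple with vertex set $[d]=\{1,\dots,d\}$; $\mathcal G_d$ is the set of all of them; $\operatorname{maxdeg}(G)$ is the maximum degree. A property $\mathcal P:\mathcal G_d\to\{0,1\}$ is monotone if $\mathcal P(G')\le\mathcal P(G)$ whenever $G'$ is a spanning subgraph of $G$ (same vertex set, $E(G')\subseteq E(G)$). The set of witnesses is $\mathcal W=\{G\in\mathcal G_d:\mathcal P(G)=1\}$. A weighted graph $G_{\boldsymbol w}=(G,\boldsymbol w)$ has weights $w_{uv}>0$ for $(u,v)\in E(G)$ and $w_{uv}=0$ otherwise. The zero-field ferromagnetic Ising model is $\mathbb P_{\theta,G_{\boldsymbol w}}(\boldsymbol X=\boldsymbol x)\propto\exp\big(\theta\sum_{(u,v)\in E(G)}w_{uv}x_ux_v\big)$, $\boldsymbol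 x\in\{\pm1\}^d$, with expectation $\mathbb E_{\theta,G_{\boldsymbol w}}$. $\mathcal G_0(\mathcal P)=\{G_{\boldsymbol w}:\mathcal P(G)=0\}$ and $$\mathcal Q(\mathcal P,\mathcal R,\theta)=\max_{G_{\boldsymbol w}\in\mathcal G_0(\mathcal P)\cap\mathcal R}\ \max_{G'\in\mathcal W}\ \min_{(u,v)\in E(G')}\mathbb E_{\theta,G_{\boldsymbol w}}X_uX_v .$$ *)

theory Defs
  imports "HOL-Probability.Probability"
begin

text \<open>All graphs have vertex set \<open>{1..d}\<close>, so a graph is given by its set of edges
  and spanning subgraphs correspond to subsets.\<close>

definition vertex_pairs :: "nat \<Rightarrow> nat set set" where
  "vertex_pairs d = {{u, v} | u v. u \<in> {1..d} \<and> v \<in> {1..d} \<and> u \<noteq> v}"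

definition graphs :: "nat \<Rightarrow> nat set set set" where
  "graphs d = Pow (vertex_pairs d)"

definition degree :: "nat set set \<Rightarrow> nat \<Rightarrow> nat" where
  "degree G v = card {e \<in> G. v \<in> e}"

text \<open>Here and in \<open>sup_norm\<close> below, the inserted 0 only matters when the maximum would
  range over the empty set.\<close>

definition maxdeg :: "nat \<Rightarrow> nat set set \<Rightarrow> nat" where
  "maxdeg d G = Max (insert 0 (degree G ` {1..d}))"

definition monotone_property :: "nat \<Rightarrow> (nat set set \<Rightarrow> bool) \<Rightarrow> bool" where
  "monotone_property d P \<longleftrightarrow>
     (\<forall>G \<in> graphs d. \<forall>G' \<in> graphs d. G' \<subseteq> G \<longrightarrow> P G' \<le> P G)"

definition witnesses :: "nat \<Rightarrow> (nat set set \<Rightarrow> bool) \<Rightarrow> nat set set set" where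
  "witnesses d P = {G \<in> graphs d. P G}"

text \<open>Weights are functions of the unordered pair: \<open>w {u, v}\<close> is the weight written
  $w_{uv}$.\<close>

type_synonym weighted_graph = "nat set set \<times> (nat set \<Rightarrow> real)"

definition weighted_graphs :: "nat \<Rightarrow> weighted_graph set" where
  "weighted_graphs d =
     {(G, w). G \<in> graphs d \<and> (\<forall>e \<in> G. w e > 0) \<and> (\<forall>e. e \<notin> G \<longrightarrow> w e = 0)}"

definition sup_norm :: "nat \<Rightarrow> (nat set \<Rightarrow> real) \<Rightarrow> real" where
  "sup_norm d w = Max (insert 0 ((\<lambda>e. \<bar>w e\<bar>) ` vertex_pairs d))"

definition spins :: "nat \<Rightarrow> (nat \<Rightarrow> real) set" where
  "spins d = {1..d} \<rightarrow>\<^sub>E {-1, 1}"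

text \<open>For an edge \<open>e = {u, v}\<close> the product over \<open>e\<close> is $x_u x_v$; each undirected edge
  is counted once.\<close>

definition ising_weight :: "real \<Rightarrow> weighted_graph \<Rightarrow> (nat \<Rightarrow> real) \<Rightarrow> real" where
  "ising_weight \<theta> = (\<lambda>(G, w) x. exp (\<theta> * (\<Sum>e\<in>G. w e * (\<Prod>i\<in>e. x i))))"

definition ising_pmf :: "nat \<Rightarrow> real \<Rightarrow> weighted_graph \<Rightarrow> (nat \<Rightarrow> real) pmf" where
  "ising_pmf d \<theta> Gw = embed_pmf (\<lambda>x.
     if x \<in> spins d then ising_weight \<theta> Gw x / (\<Sum>y\<in>spins d. ising_weight \<theta> Gw y) else 0)"

definition correlation :: "nat \<Rightarrow> real \<Rightarrow> weighted_graph \<Rightarrow> nat \<Rightarrow> nat \<Rightarrow> real" where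
  "correlation d \<theta> Gw u v = measure_pmf.expectation (ising_pmf d \<theta> Gw) (\<lambda>x. x u * x v)"

lemma finite_spins: "finite (spins d)"
  unfolding spins_def by (intro finite_PiE) auto

lemma spins_nonempty: "spins d \<noteq> {}"
  unfolding spins_def by (simp add: PiE_eq_empty_iff)

lemma ising_weight_pos: "ising_weight \<theta> Gw x > 0"
  by (simp add: ising_weight_def split: prod.split)

lemma partition_function_pos: "(\<Sum>y\<in>spins d. ising_weight \<theta> Gw y) > 0"
  by (intro sum_pos finite_spins spins_nonempty ising_weight_pos)

text \<open>The argument of \<open>embed_pmf\<close> is a probability mass function, so \<open>ising_pmf\<close> is the
  intended distribution.\<close>

lemma pmf_ising_pmf:
  "pmf (ising_pmf d \<theta> Gw) x =
     (if x \<in> spins d then ising_weight \<theta> Gw x / (\<Sum>y\<in>spins d. ising_weight \<theta> Gw y) else 0)"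
proof -
  define Z where "Z = (\<Sum>y\<in>spins d. ising_weight \<theta> Gw y)"
  define f where "f = (\<lambda>x. if x \<in> spins d then ising_weight \<theta> Gw x / Z else 0)"
  have Z: "Z > 0"
    unfolding Z_def by (rule partition_function_pos)
  have nonneg: "0 \<le> f x" for x
    using Z ising_weight_pos[of \<theta> Gw x] by (simp add: f_def less_imp_le)
  have "(\<integral>\<^sup>+ x. ennreal (f x) \<partial>count_space UNIV) = (\<Sum>x\<in>spins d. ennreal (f x))"
    by (rule nn_integral_count_space'[OF finite_spins]) (auto simp: f_def)
  also have "\<dots> = ennreal (\<Sum>x\<in>spins d. f x)"
    by (intro sum_ennreal nonneg)
  also have "(\<Sum>x\<in>spins d. f x) = 1"
    using Z by (simp add: f_def Z_def sum_divide_distrib[symmetric])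
  finally have "(\<integral>\<^sup>+ x. ennreal (f x) \<partial>count_space UNIV) = 1"
    by simp
  from pmf_embed_pmf[OF nonneg this, of x] show ?thesis
    unfolding ising_pmf_def f_def Z_def by simp
qed

lemma set_ising_pmf: "set_pmf (ising_pmf d \<theta> Gw) = spins d"
  using ising_weight_pos[of \<theta> Gw] partition_function_pos[where d = d and \<theta> = \<theta> and Gw = Gw]
  by (auto simp: set_pmf_eq pmf_ising_pmf less_le)

lemma correlation_eq_sum:
  "correlation d \<theta> Gw u v =
     (\<Sum>x\<in>spins d. x u * x v * ising_weight \<theta> Gw x) / (\<Sum>x\<in>spins d. ising_weight \<theta> Gw x)"
proof -
  have "correlation d \<theta> Gw u v =
      (\<Sum>x\<in>spins d. pmf (ising_pmf d \<theta> Gw) x *\<^sub>R (x u * x v))"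
    unfolding correlation_def
    by (rule integral_measure_pmf[OF finite_spins]) (simp add: set_ising_pmf)
  then show ?thesis
    by (simp add: pmf_ising_pmf sum_divide_distrib mult.commute)
qed

definition null_graphs :: "nat \<Rightarrow> (nat set set \<Rightarrow> bool) \<Rightarrow> weighted_graph set" where
  "null_graphs d P = {(G, w) \<in> weighted_graphs d. \<not> P G}"

text \<open>The outer maximum ranges over an infinite family, and both maxima range over the
  empty set if \<open>P\<close> is constant, so maxima and minima are taken as suprema and infima in
  \<^typ>\<open>ereal\<close>, with the usual conventions for empty index sets. The minimum is over a nonempty
  set whenever it matters: if \<open>P\<close> is monotone and the edgeless graph is a witness, then
  \<open>null_graphs d P\<close> is empty.\<close>

definition Q :: "nat \<Rightarrow> (nat set set \<Rightarrow> bool) \<Rightarrow> weighted_graph set \<Rightarrow> real \<Rightarrow> ereal" where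
  "Q d P \<R> \<theta> =
     (SUP Gw \<in> null_graphs d P \<inter> \<R>. SUP G' \<in> witnesses d P.
        INF (u, v) \<in> {(u, v). {u, v} \<in> G'}. ereal (correlation d \<theta> Gw u v))"

definition restriction_set :: "nat \<Rightarrow> real \<Rightarrow> nat \<Rightarrow> real \<Rightarrow> weighted_graph set" where
  "restriction_set d \<theta> s \<Theta> =
     {(G, w) \<in> weighted_graphs d. maxdeg d G \<le> s \<and> sup_norm d w \<le> \<Theta> / \<theta>}"

definition R :: "nat \<Rightarrow> real \<Rightarrow> real" where
  "R s \<Theta> =
     (cosh (2 * real s * \<Theta>)
        + 2 * real s * exp (- 2 * (real s - 1) * \<Theta>) * cosh (2 * (real s - 1) * \<Theta>))
     / (2 * real s * exp (- 2 * (real s - 1) * \<Theta>) * cosh (2 * \<Theta>) + 1)"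

end

theory Submission
  imports Defs
begin

text \<open>
  If \<open>G\<close> fails a monotone property and \<open>G'\<close> has it, then \<open>G'\<close> has an edge \<open>{u, v}\<close> outside \<open>G\<close>.
  Both bounds are therefore bounds on the correlation of two non-adjacent vertices in a
  ferromagnetic Ising model with maximum degree at most \<open>s\<close> and couplings at most \<open>\<Theta>\<close>
  (\<open>Q_le_if_nonadjacent_correlation_le\<close>). The two bounds rest on different ideas.

  The bound in terms of \<open>tanh\<close> comes from the high-temperature expansion, where a correlation is at most a
  sum over trails from \<open>u\<close> to \<open>v\<close> of products of hyperbolic tangents of the couplings. A trail of
  length \<open>l\<close> ending at \<open>v\<close> has at most \<open>s (s - 1)\<^sup>l\<^sup>-\<^sup>2\<close> choices, because its last step is forced, and
  \<open>l \<ge> 2\<close> as \<open>u\<close> and \<open>v\<close> are not adjacent. The geometric series over \<open>l\<close> gives the bound. Formally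
  the trails are built one edge at a time by an inequality that peels the edges off the first
  vertex (\<open>moment_peel\<close>), and the series is summed by induction on the edge set
  (\<open>moment_trail_bound\<close>).

  The bound in terms of \<open>R\<close> says that the odds of \<open>x\<^sub>u = x\<^sub>v\<close> against \<open>x\<^sub>u \<noteq> x\<^sub>v\<close> are at
  most \<open>R s \<Theta>\<close>. As a homogeneous linear inequality in the Boltzmann weights this is preserved by nonnegative
  combinations, and \<open>exp (J y)\<close> is such a combination of \<open>1\<close> and \<open>exp (\<Theta> y)\<close> for a sign \<open>y\<close> and
  \<open>0 \<le> J \<le> \<Theta>\<close>. It thus suffices to treat couplings that all equal \<open>\<Theta>\<close> on a subgraph
  (\<open>weighted_sum_nonneg_if_uniform\<close>). Pendant vertices attached to \<open>u\<close> or \<open>v\<close> do not change their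
  correlation, so both may be assumed to have degree exactly \<open>s\<close> (\<open>odds_sum_pendant\<close>).

  Summing out \<open>x\<^sub>u\<close> and \<open>x\<^sub>v\<close> leaves a weighted sum of \<open>R cosh (\<Theta> (h\<^sub>u - h\<^sub>v)) - cosh (\<Theta> (h\<^sub>u + h\<^sub>v))\<close>,
  with \<open>h\<^sub>u\<close> and \<open>h\<^sub>v\<close> the sums of the spins of the neighbours. A term is negative only if all neighbours of
  \<open>u\<close> and \<open>v\<close> carry the same spin. Such a configuration is compensated by the configurations that
  arise from it by flipping one neighbour: a flip multiplies the weight by at least
  \<open>exp (- 2 (s - 1) \<Theta>)\<close>, and \<open>R\<close> is the value for which \<open>2 s\<close> such flips restore the balance
  exactly (\<open>R_balance\<close>). A common neighbour of \<open>u\<close> and \<open>v\<close> replaces two of the \<open>2 s\<close> flips by one, which for \<open>s \<ge> 3\<close>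
  compensates at least as much (\<open>shared_flip_gain\<close>). For \<open>s \<ge> 3\<close> there are also at least three neighbours, so
  different unanimous configurations never share a flipped one (\<open>inj_on_flip\<close>).
\<close>

section \<open>Spin configurations and neighbourhoods\<close>

text \<open>
  The vertex set is arbitrary, since vertices will be removed and added.
\<close>

definition configs :: "nat set \<Rightarrow> (nat \<Rightarrow> real) set" where
  "configs V = V \<rightarrow>\<^sub>E {-1, 1}"

definition simple_graph :: "nat set \<Rightarrow> nat set set \<Rightarrow> bool" where
  "simple_graph V G \<longleftrightarrow> (\<forall>e\<in>G. \<exists>a\<in>V. \<exists>b\<in>V. a \<noteq> b \<and> e = {a, b})"

definition nbrs :: "nat set set \<Rightarrow> nat \<Rightarrow> nat set" where
  "nbrs G u = {w. {u, w} \<in> G}"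

abbreviation edge_spin :: "(nat \<Rightarrow> real) \<Rightarrow> nat set \<Rightarrow> real" where
  "edge_spin x e \<equiv> \<Prod>i\<in>e. x i"

lemma spins_eq_configs: "spins d = configs {1..d}"
  by (simp add: spins_def configs_def)

lemma finite_configs: "finite V \<Longrightarrow> finite (configs V)"
  unfolding configs_def by (intro finite_PiE) auto

lemma configs_cases: "x \<in> configs V \<Longrightarrow> i \<in> V \<Longrightarrow> x i = 1 \<or> x i = -1"
  by (auto simp: configs_def PiE_def Pi_def)

lemma configs_square: "x \<in> configs V \<Longrightarrow> i \<in> V \<Longrightarrow> x i * x i = 1"
  using configs_cases by fastforce

lemma configs_upd:
  assumes "x \<in> configs V" "i \<in> V" "a = 1 \<or> a = -1"
  shows "x(i := a) \<in> configs V"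
  using assms unfolding configs_def by (auto simp: PiE_def Pi_def extensional_def)

lemma sum_configs_insert:
  fixes f :: "(nat \<Rightarrow> real) \<Rightarrow> real"
  assumes "finite V" "p \<notin> V"
  shows "(\<Sum>x\<in>configs (insert p V). f x) = (\<Sum>y\<in>configs V. f (y(p := 1)) + f (y(p := -1)))"
proof -
  have inj: "inj_on (\<lambda>(a, y). y(p := a)) ({-1, 1} \<times> (V \<rightarrow>\<^sub>E {-1, 1 :: real}))"
    using inj_combinator[OF assms(2), of "\<lambda>_. {-1, 1}"] by simp
  have "(\<Sum>x\<in>configs (insert p V). f x) = (\<Sum>(a, y)\<in>{-1, 1} \<times> configs V. f (y(p := a)))"
    unfolding configs_def PiE_insert_eq sum.reindex[OF inj] by (simp add: case_prod_unfold)
  also have "\<dots> = (\<Sum>a\<in>{-1, 1}. \<Sum>y\<in>configs V. f (y(p := a)))"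
    by (simp add: sum.cartesian_product)
  also have "\<dots> = (\<Sum>y\<in>configs V. f (y(p := 1)) + f (y(p := -1)))"
    by (simp add: sum.distrib)
  finally show ?thesis .
qed

lemma simple_graph_finite: "finite V \<Longrightarrow> simple_graph V G \<Longrightarrow> finite G"
  by (rule finite_subset[of _ "Pow V"]) (auto simp: simple_graph_def)

lemma simple_graph_subset: "simple_graph V G \<Longrightarrow> H \<subseteq> G \<Longrightarrow> simple_graph V H"
  unfolding simple_graph_def by blast

lemma simple_graph_edgeD:
  assumes "simple_graph V G" "{a, b} \<in> G"
  shows "a \<in> V" "b \<in> V" "a \<noteq> b"
  using assms unfolding simple_graph_def by (auto simp: doubleton_eq_iff)

lemma nbrs_subset: "simple_graph V G \<Longrightarrow> nbrs G u \<subseteq> V"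
  using simple_graph_edgeD by (auto simp: nbrs_def)

lemma finite_nbrs: "finite V \<Longrightarrow> simple_graph V G \<Longrightarrow> finite (nbrs G u)"
  by (rule finite_subset[OF nbrs_subset])

lemma star_eq: "simple_graph V G \<Longrightarrow> {e \<in> G. u \<in> e} = (\<lambda>w. {u, w}) ` nbrs G u"
proof (intro equalityI subsetI)
  fix e assume "simple_graph V G" "e \<in> {e \<in> G. u \<in> e}"
  then obtain a b where "e = {a, b}" "e \<in> G" "u = a \<or> u = b"
    unfolding simple_graph_def by blast
  then show "e \<in> (\<lambda>w. {u, w}) ` nbrs G u"
    by (auto simp: nbrs_def insert_commute)
qed (auto simp: nbrs_def)

lemma inj_star: "inj_on (\<lambda>w. {u, w}) A"
  by (auto simp: inj_on_def doubleton_eq_iff)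

lemma card_nbrs: "simple_graph V G \<Longrightarrow> card (nbrs G u) = degree G u"
  unfolding degree_def star_eq by (simp add: card_image inj_star)

lemma degree_mono: "finite G \<Longrightarrow> H \<subseteq> G \<Longrightarrow> degree H w \<le> degree G w"
  unfolding degree_def by (intro card_mono) auto

lemma edge_spin_config:
  assumes "x \<in> configs V" "simple_graph V G" "e \<in> G"
  shows "edge_spin x e = 1 \<or> edge_spin x e = -1"
proof -
  obtain a b where ab: "a \<in> V" "b \<in> V" "a \<noteq> b" "e = {a, b}"
    using assms(2,3) unfolding simple_graph_def by blast
  show ?thesis
    using configs_cases[OF assms(1) ab(1)] configs_cases[OF assms(1) ab(2)] ab by auto
qed

section \<open>Correlations bounded by a sum over trails\<close>

text \<open>
  Since \<open>exp (J y) = cosh J * (1 + tanh J * y)\<close> for a sign \<open>y\<close>, this is the unnormalised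
  expectation of \<open>f\<close> in the Ising model with \<open>t e = tanh (J e)\<close>, up to a factor that does not
  depend on \<open>f\<close>.
\<close>

definition moment ::
    "nat set \<Rightarrow> (nat set \<Rightarrow> real) \<Rightarrow> nat set set \<Rightarrow> ((nat \<Rightarrow> real) \<Rightarrow> real) \<Rightarrow> real" where
  "moment V t G f = (\<Sum>x\<in>configs V. f x * (\<Prod>e\<in>G. 1 + t e * edge_spin x e))"

text \<open>
  Multiplication by an edge spin does not lead out of this class, so statements about the moments of monomials
  can be proved by adding one edge at a time.
\<close>

definition spin_monomial :: "nat set \<Rightarrow> ((nat \<Rightarrow> real) \<Rightarrow> real) \<Rightarrow> bool" where
  "spin_monomial V f \<longleftrightarrow> (\<exists>n. \<forall>x\<in>configs V. f x = (\<Prod>i\<in>V. x i ^ n i))"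

lemma spin_monomial_one: "spin_monomial V (\<lambda>x. 1)"
  unfolding spin_monomial_def by (rule exI[of _ "\<lambda>_. 0"]) simp

lemma spin_monomial_prod:
  assumes "finite V" "A \<subseteq> V"
  shows "spin_monomial V (\<lambda>x. \<Prod>i\<in>A. x i)"
  unfolding spin_monomial_def
proof (intro exI[of _ "\<lambda>i. if i \<in> A then 1 else 0"] ballI)
  fix x :: "nat \<Rightarrow> real"
  show "(\<Prod>i\<in>A. x i) = (\<Prod>i\<in>V. x i ^ (if i \<in> A then 1 else 0))"
    using assms by (intro prod.mono_neutral_cong_left) auto
qed

lemma spin_monomial_mult:
  assumes "spin_monomial V f" "spin_monomial V g"
  shows "spin_monomial V (\<lambda>x. f x * g x)"
proof -
  obtain n m where "\<forall>x\<in>configs V. f x = (\<Prod>i\<in>V. x i ^ n i)"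
      "\<forall>x\<in>configs V. g x = (\<Prod>i\<in>V. x i ^ m i)"
    using assms unfolding spin_monomial_def by blast
  then show ?thesis
    unfolding spin_monomial_def
    by (intro exI[of _ "\<lambda>i. n i + m i"]) (auto simp: power_add prod.distrib)
qed

lemma spin_monomial_pair:
  assumes "finite V" "u \<in> V" "v \<in> V"
  shows "spin_monomial V (\<lambda>x. x u * x v)"
  using spin_monomial_mult[OF spin_monomial_prod[of V "{u}"] spin_monomial_prod[of V "{v}"]] assms
  by simp

lemma moment_insert:
  assumes "finite G" "e \<notin> G"
  shows "moment V t (insert e G) f = moment V t G f + t e * moment V t G (\<lambda>x. edge_spin x e * f x)"
  using assms by (simp add: moment_def sum.distrib sum_distrib_left algebra_simps)

text \<open>
  Griffiths' first inequality. Multiplying out the edge factors leaves sums of monomials over all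
  configurations with the uniform weight, and these factor over the vertices into sums
  \<open>1 + (-1)\<^sup>n\<close>, which are 0 or 2.
\<close>

lemma moment_nonneg:
  assumes "finite V" "simple_graph V G" "\<And>e. e \<in> G \<Longrightarrow> t e \<ge> 0" "spin_monomial V f"
  shows "moment V t G f \<ge> 0"
proof -
  have "finite G" using simple_graph_finite assms by blast
  then show ?thesis using assms
  proof (induction G arbitrary: f rule: finite_induct)
    case empty
    then obtain n where n: "\<forall>x\<in>configs V. f x = (\<Prod>i\<in>V. x i ^ n i)"
      unfolding spin_monomial_def by blast
    have "moment V t {} f = (\<Sum>x\<in>configs V. \<Prod>i\<in>V. x i ^ n i)"
      unfolding moment_def using n by simp
    also have "\<dots> = (\<Prod>i\<in>V. \<Sum>a\<in>{-1, 1 :: real}. a ^ n i)"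
      unfolding configs_def using empty.prems(1)
      by (subst prod_sum_PiE[where B = "\<lambda>_. {-1, 1}"]) auto
    also have "\<dots> \<ge> 0"
      by (intro prod_nonneg) (auto simp: uminus_power_if)
    finally show ?case .
  next
    case (insert e G)
    have "simple_graph V G" "e \<subseteq> V"
      using insert.prems(2) by (auto simp: simple_graph_def)
    then have "moment V t G f \<ge> 0" "moment V t G (\<lambda>x. edge_spin x e * f x) \<ge> 0"
      using insert.prems
      by (auto intro!: insert.IH spin_monomial_mult spin_monomial_prod)
    then show ?case
      using insert by (simp add: moment_insert)
  qed
qed

text \<open>
  Each additional edge \<open>e\<close> contributes \<open>t e\<close> times the moment of another monomial.
\<close>

lemma moment_mono:
  assumes "finite V" "simple_graph V G" "\<And>e. e \<in> G \<Longrightarrow> t e \<ge> 0" "spin_monomial V f" "H \<subseteq> G"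
  shows "moment V t H f \<le> moment V t G f"
proof -
  have "finite (G - H)"
    using simple_graph_finite assms by blast
  moreover have "moment V t H f \<le> moment V t (H \<union> S) f" if "finite S" "S \<subseteq> G - H" for S
    using that
  proof (induction S rule: finite_induct)
    case (insert e S)
    have sub: "simple_graph V (H \<union> S)" and e: "e \<subseteq> V" "e \<in> G"
      using simple_graph_subset[OF assms(2)] assms(5) insert.prems assms(2)
      by (auto simp: simple_graph_def)
    have "0 \<le> t e * moment V t (H \<union> S) (\<lambda>x. edge_spin x e * f x)"
      using assms e insert.prems
      by (intro mult_nonneg_nonneg moment_nonneg sub spin_monomial_mult spin_monomial_prod) auto
    moreover have "moment V t (insert e (H \<union> S)) f
        = moment V t (H \<union> S) f + t e * moment V t (H \<union> S) (\<lambda>x. edge_spin x e * f x)"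
      using insert simple_graph_finite[OF assms(1) sub] by (intro moment_insert) auto
    ultimately show ?case
      using insert by simp
  qed simp
  ultimately have "moment V t H f \<le> moment V t (H \<union> (G - H)) f"
    by blast
  then show ?thesis
    using assms(5) by (simp add: Un_absorb1)
qed

text \<open>
  The spin at an isolated vertex can be flipped at no cost, so the terms cancel in pairs.
\<close>

lemma moment_isolated:
  assumes "finite V" "w \<in> V" "w \<noteq> v" "\<And>e. e \<in> G \<Longrightarrow> w \<notin> e"
  shows "moment V t G (\<lambda>x. x w * x v) = 0"
proof -
  obtain V0 where V: "V = insert w V0" "w \<notin> V0"
    using assms(2) by (meson mk_disjoint_insert)
  have "(\<Prod>e\<in>G. 1 + t e * edge_spin (y(w := a)) e) = (\<Prod>e\<in>G. 1 + t e * edge_spin y e)"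
    for y :: "nat \<Rightarrow> real" and a
  proof (rule prod.cong)
    fix e assume "e \<in> G"
    then have "edge_spin (y(w := a)) e = edge_spin y e"
      using assms(4) by (intro prod.cong) auto
    then show "1 + t e * edge_spin (y(w := a)) e = 1 + t e * edge_spin y e" by simp
  qed simp
  then show ?thesis
    using assms V by (simp add: moment_def sum_configs_insert del: fun_upd_apply) simp
qed

text \<open>
  The first step of a trail: the edges at \<open>w\<close> are removed one at a time. Removing \<open>e = {w, z}\<close> leaves a term
  with \<open>t e\<close> in which the edge spin turns \<open>x\<^sub>w x\<^sub>v\<close> into \<open>x\<^sub>z x\<^sub>v\<close>; by monotonicity the previously removed
  edges may be put back in that term. When no edge is left at \<open>w\<close>, the remaining moment vanishes.
\<close>

lemma moment_peel:
  assumes V: "finite V" and G: "simple_graph V G" and t: "\<And>e. e \<in> G \<Longrightarrow> t e \<ge> 0"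
    and w: "w \<in> V" "v \<in> V" "w \<noteq> v"
  shows "moment V t G (\<lambda>x. x w * x v)
      \<le> (\<Sum>z\<in>nbrs G w. t {w, z} * moment V t (G - {{w, z}}) (\<lambda>x. x z * x v))"
proof -
  define f where "f = (\<lambda>x :: nat \<Rightarrow> real. x w * x v)"
  define S where "S = {e \<in> G. w \<in> e}"
  have finG: "finite G" using simple_graph_finite V G by blast
  have f: "spin_monomial V f" unfolding f_def using spin_monomial_pair V w by blast
  \<comment> \<open>\<open>T\<close> is the set of edges at \<open>w\<close> that have been removed so far.\<close>
  have peel: "moment V t G f \<le> moment V t (G - T) f
      + (\<Sum>e\<in>T. t e * moment V t (G - {e}) (\<lambda>x. edge_spin x e * f x))"
    if "finite T" "T \<subseteq> S" for T
    using that
  proof (induction T rule: finite_induct)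
    case (insert e T)
    have e: "e \<in> G" "e \<subseteq> V" using insert.prems G unfolding S_def simple_graph_def by auto
    have "moment V t (insert e (G - insert e T)) f = moment V t (G - insert e T) f
        + t e * moment V t (G - insert e T) (\<lambda>x. edge_spin x e * f x)"
      using finG by (intro moment_insert) auto
    moreover have "insert e (G - insert e T) = G - T"
      using e insert by auto
    moreover have "moment V t (G - insert e T) (\<lambda>x. edge_spin x e * f x)
        \<le> moment V t (G - {e}) (\<lambda>x. edge_spin x e * f x)"
      using V t e f G
      by (intro moment_mono simple_graph_subset[OF G] spin_monomial_mult spin_monomial_prod) auto
    ultimately have "moment V t (G - T) f \<le> moment V t (G - insert e T) f
        + t e * moment V t (G - {e}) (\<lambda>x. edge_spin x e * f x)"
      using t[OF e(1)] by (simp add: mult_left_mono)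
    then show ?case using insert by simp
  qed simp
  have isolated: "moment V t (G - S) f = 0"
    unfolding f_def S_def using V w by (intro moment_isolated) auto
  have "moment V t G f \<le> (\<Sum>e\<in>S. t e * moment V t (G - {e}) (\<lambda>x. edge_spin x e * f x))"
    using peel[of S] isolated finG by (simp add: S_def)
  also have "\<dots> = (\<Sum>z\<in>nbrs G w. t {w, z} * moment V t (G - {{w, z}}) (\<lambda>x. edge_spin x {w, z} * f x))"
    unfolding S_def star_eq[OF G] by (simp add: sum.reindex inj_star)
  also have "\<dots> = (\<Sum>z\<in>nbrs G w. t {w, z} * moment V t (G - {{w, z}}) (\<lambda>x. x z * x v))"
  proof (intro sum.cong refl arg_cong[of _ _ "\<lambda>a. _ * a"])
    fix z assume "z \<in> nbrs G w"
    then have "w \<noteq> z" using simple_graph_edgeD[OF G] by (auto simp: nbrs_def)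
    then have "edge_spin x {w, z} * f x = x z * x v" if "x \<in> configs V" for x
      using configs_square[OF that w(1)] unfolding f_def by (simp add: algebra_simps)
    then show "moment V t (G - {{w, z}}) (\<lambda>x. edge_spin x {w, z} * f x)
        = moment V t (G - {{w, z}}) (\<lambda>x. x z * x v)"
      unfolding moment_def by (intro sum.cong) auto
  qed
  finally show ?thesis unfolding f_def .
qed

lemma degree_remove_edge:
  assumes "finite G" "{w, z} \<in> G"
  shows "degree (G - {{w, z}}) z + 1 = degree G z"
proof -
  have "{e \<in> G. z \<in> e} = insert {w, z} {e \<in> G - {{w, z}}. z \<in> e}" using assms by auto
  then show ?thesis unfolding degree_def using assms by simp
qed

text \<open>
  \<open>M\<close> is the sum of the series \<open>\<Sum>l\<ge>1. (s - 1)\<^sup>l\<^sup>-\<^sup>1 \<tau>\<^sup>l\<close> over the lengths of trails from \<open>w\<close> to \<open>v\<close>,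
  given through its fixed-point equation, which is the form the induction uses. Among the neighbours of \<open>w\<close>,
  at most one is \<open>v\<close> and ends the trail, which accounts for the summand 1; each of the at most
  \<open>s - 1\<close> others has lost the edge just used, so it has at most \<open>s - 1\<close> edges left and
  the bound applies again.
\<close>

lemma moment_trail_bound:
  fixes \<tau> M :: real
  assumes V: "finite V" and \<tau>: "\<tau> \<ge> 0" "M = \<tau> * (1 + (real s - 1) * M)" "M \<ge> 0" and v: "v \<in> V"
    and "simple_graph V G" "\<And>e. e \<in> G \<Longrightarrow> 0 \<le> t e \<and> t e \<le> \<tau>"
    and "\<And>i. i \<in> V \<Longrightarrow> degree G i \<le> s"
    and "w \<in> V" "w \<noteq> v" "degree G w + 1 \<le> s"
  shows "moment V t G (\<lambda>x. x w * x v) \<le> M * moment V t G (\<lambda>x. 1)"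
  using assms(6-)
proof (induction "card G" arbitrary: G w rule: less_induct)
  case less
  note G = less.prems(1)
  let ?Z = "moment V t G (\<lambda>x. 1)"
  have finG: "finite G" using simple_graph_finite V G by blast
  have Z: "?Z \<ge> 0" using less.prems by (intro moment_nonneg V spin_monomial_one) auto
  have bound: "moment V t (G - {{w, z}}) (\<lambda>x. x z * x v) \<le> (if z = v then 1 else M) * ?Z"
    if z: "z \<in> nbrs G w" for z
  proof -
    have wz: "{w, z} \<in> G" using z by (simp add: nbrs_def)
    have sub: "simple_graph V (G - {{w, z}})" using simple_graph_subset[OF G] by blast
    have le: "moment V t (G - {{w, z}}) (\<lambda>x. 1) \<le> ?Z"
      using less.prems by (intro moment_mono V spin_monomial_one) auto
    show ?thesis
    proof (cases "z = v")
      case True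
      have "moment V t (G - {{w, z}}) (\<lambda>x. x z * x v) = moment V t (G - {{w, z}}) (\<lambda>x. 1)"
        unfolding moment_def using True v configs_square by (intro sum.cong) auto
      then show ?thesis using le True by simp
    next
      case False
      have zV: "z \<in> V" using simple_graph_edgeD[OF G wz] by simp
      have "moment V t (G - {{w, z}}) (\<lambda>x. x z * x v) \<le> M * moment V t (G - {{w, z}}) (\<lambda>x. 1)"
      proof (rule less.hyps)
        show "card (G - {{w, z}}) < card G" using wz finG by (intro psubset_card_mono) auto
        show "degree (G - {{w, z}}) z + 1 \<le> s"
          using degree_remove_edge[OF finG wz] less.prems(3)[OF zV] by simp
        show "degree (G - {{w, z}}) i \<le> s" if "i \<in> V" for i
          using degree_mono[OF finG, of "G - {{w, z}}" i] less.prems(3)[OF that] by auto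
      qed (use sub less.prems zV False in auto)
      also have "\<dots> \<le> M * ?Z" using le \<tau>(3) by (intro mult_left_mono)
      finally show ?thesis using False by simp
    qed
  qed
  have "moment V t G (\<lambda>x. x w * x v)
      \<le> (\<Sum>z\<in>nbrs G w. t {w, z} * moment V t (G - {{w, z}}) (\<lambda>x. x z * x v))"
    using less.prems by (intro moment_peel V v) auto
  also have "\<dots> \<le> (\<Sum>z\<in>nbrs G w. \<tau> * ((if z = v then 1 else M) * ?Z))"
  proof (rule sum_mono)
    fix z assume z: "z \<in> nbrs G w"
    then have t: "0 \<le> t {w, z}" "t {w, z} \<le> \<tau>" using less.prems(2) by (auto simp: nbrs_def)
    have "t {w, z} * moment V t (G - {{w, z}}) (\<lambda>x. x z * x v)
        \<le> t {w, z} * ((if z = v then 1 else M) * ?Z)"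
      using bound[OF z] t by (intro mult_left_mono)
    also have "\<dots> \<le> \<tau> * ((if z = v then 1 else M) * ?Z)"
      using t Z \<tau> by (intro mult_right_mono) auto
    finally show "t {w, z} * moment V t (G - {{w, z}}) (\<lambda>x. x z * x v)
        \<le> \<tau> * ((if z = v then 1 else M) * ?Z)" .
  qed
  also have "\<dots> = \<tau> * ?Z * (\<Sum>z\<in>nbrs G w. if z = v then 1 else M)"
    by (simp add: sum_distrib_left algebra_simps)
  also have "\<dots> \<le> \<tau> * ?Z * (1 + (real s - 1) * M)"
  proof (intro mult_left_mono)
    have "(\<Sum>z\<in>nbrs G w. if z = v then 1 else M) \<le> (\<Sum>z\<in>nbrs G w. (if z = v then 1 else 0) + M)"
      using \<tau>(3) by (intro sum_mono) auto
    also have "\<dots> = (if v \<in> nbrs G w then 1 else 0) + real (degree G w) * M"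
      using finite_nbrs[OF V G] by (simp add: sum.distrib card_nbrs[OF G])
    also have "\<dots> \<le> 1 + (real s - 1) * M"
      using less.prems(6) \<tau>(3) by (intro add_mono mult_right_mono) auto
    finally show "(\<Sum>z\<in>nbrs G w. if z = v then 1 else M) \<le> 1 + (real s - 1) * M" .
  qed (use Z \<tau> in auto)
  also have "\<dots> = M * ?Z" using \<tau>(2) by (metis mult.assoc mult.commute)
  finally show ?case .
qed

text \<open>
  The first vertex has up to \<open>s\<close> neighbours, one more than the vertices reached later, and none of them is
  \<open>v\<close>. This gives \<open>s * \<tau> * M\<close> with \<open>M\<close> as in the previous lemma.
\<close>

lemma moment_nonadjacent_bound:
  fixes \<tau> :: real
  assumes V: "finite V" and \<tau>: "\<tau> \<ge> 0" "(real s - 1) * \<tau> < 1"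
    and G: "simple_graph V G" and t: "\<And>e. e \<in> G \<Longrightarrow> 0 \<le> t e \<and> t e \<le> \<tau>"
    and deg: "\<And>i. i \<in> V \<Longrightarrow> degree G i \<le> s"
    and uv: "u \<in> V" "v \<in> V" "u \<noteq> v" "{u, v} \<notin> G"
  shows "moment V t G (\<lambda>x. x u * x v)
      \<le> real s * \<tau>\<^sup>2 / (1 - (real s - 1) * \<tau>) * moment V t G (\<lambda>x. 1)"
proof -
  define M where "M = \<tau> / (1 - (real s - 1) * \<tau>)"
  let ?Z = "moment V t G (\<lambda>x. 1)"
  have M: "M \<ge> 0" "M = \<tau> * (1 + (real s - 1) * M)"
    using \<tau> unfolding M_def by (auto simp: field_simps)
  have finG: "finite G" using simple_graph_finite V G by blast
  have Z: "?Z \<ge> 0" using t by (intro moment_nonneg V G spin_monomial_one) auto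
  have "moment V t G (\<lambda>x. x u * x v)
      \<le> (\<Sum>z\<in>nbrs G u. t {u, z} * moment V t (G - {{u, z}}) (\<lambda>x. x z * x v))"
    using t uv by (intro moment_peel V G) auto
  also have "\<dots> \<le> (\<Sum>z\<in>nbrs G u. \<tau> * (M * ?Z))"
  proof (rule sum_mono)
    fix z assume z: "z \<in> nbrs G u"
    then have uz: "{u, z} \<in> G" by (simp add: nbrs_def)
    have zV: "z \<in> V" using simple_graph_edgeD[OF G uz] by simp
    have zv: "z \<noteq> v" using uz uv by auto
    have sub: "simple_graph V (G - {{u, z}})" using simple_graph_subset[OF G] by blast
    have "moment V t (G - {{u, z}}) (\<lambda>x. x z * x v) \<le> M * moment V t (G - {{u, z}}) (\<lambda>x. 1)"
    proof (rule moment_trail_bound[OF V \<tau>(1) M(2,1) uv(2) sub])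
      show "degree (G - {{u, z}}) z + 1 \<le> s"
        using degree_remove_edge[OF finG uz] deg[OF zV] by simp
      show "degree (G - {{u, z}}) i \<le> s" if "i \<in> V" for i
        using degree_mono[OF finG, of "G - {{u, z}}" i] deg[OF that] by auto
    qed (use t zV zv in auto)
    also have "\<dots> \<le> M * ?Z"
      using t M by (intro mult_left_mono moment_mono V G spin_monomial_one) auto
    finally have "t {u, z} * moment V t (G - {{u, z}}) (\<lambda>x. x z * x v) \<le> t {u, z} * (M * ?Z)"
      using t[OF uz] by (intro mult_left_mono) auto
    also have "\<dots> \<le> \<tau> * (M * ?Z)"
      using t[OF uz] M Z by (intro mult_right_mono) auto
    finally show "t {u, z} * moment V t (G - {{u, z}}) (\<lambda>x. x z * x v) \<le> \<tau> * (M * ?Z)" .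
  qed
  also have "\<dots> = real (degree G u) * (\<tau> * (M * ?Z))"
    by (simp add: card_nbrs[OF G])
  also have "\<dots> \<le> real s * (\<tau> * (M * ?Z))"
    using deg[OF uv(1)] \<tau> M Z by (intro mult_right_mono) auto
  also have "\<dots> = real s * \<tau>\<^sup>2 / (1 - (real s - 1) * \<tau>) * ?Z"
    by (simp add: M_def power2_eq_square)
  finally show ?thesis .
qed

lemma exp_mult_sign:
  assumes "y = 1 \<or> y = (-1 :: real)"
  shows "exp (J * y) = cosh J * (1 + tanh J * y)"
  using assms by (auto simp: tanh_def algebra_simps cosh_plus_sinh cosh_minus_sinh)

lemma ising_sum_nonadjacent_bound:
  fixes \<Theta> :: real
  assumes V: "finite V" and \<Theta>: "(real s - 1) * tanh \<Theta> < 1"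
    and G: "simple_graph V G" and J: "\<And>e. e \<in> G \<Longrightarrow> 0 \<le> J e \<and> J e \<le> \<Theta>" and \<Theta>0: "\<Theta> \<ge> 0"
    and deg: "\<And>i. i \<in> V \<Longrightarrow> degree G i \<le> s"
    and uv: "u \<in> V" "v \<in> V" "u \<noteq> v" "{u, v} \<notin> G"
  shows "(\<Sum>x\<in>configs V. x u * x v * exp (\<Sum>e\<in>G. J e * edge_spin x e))
      \<le> real s * (tanh \<Theta>)\<^sup>2 / (1 - (real s - 1) * tanh \<Theta>)
        * (\<Sum>x\<in>configs V. exp (\<Sum>e\<in>G. J e * edge_spin x e))"
proof -
  define t where "t e = tanh (J e)" for e
  have finG: "finite G" using simple_graph_finite V G by blast
  have eq: "(\<Sum>x\<in>configs V. f x * exp (\<Sum>e\<in>G. J e * edge_spin x e))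
      = (\<Prod>e\<in>G. cosh (J e)) * moment V t G f" for f :: "(nat \<Rightarrow> real) \<Rightarrow> real"
  proof -
    have "exp (\<Sum>e\<in>G. J e * edge_spin x e)
        = (\<Prod>e\<in>G. cosh (J e)) * (\<Prod>e\<in>G. 1 + t e * edge_spin x e)" if "x \<in> configs V" for x
      unfolding exp_sum[OF finG] prod.distrib[symmetric] t_def
      using edge_spin_config[OF that G] by (intro prod.cong exp_mult_sign) auto
    then show ?thesis
      unfolding moment_def sum_distrib_left by (intro sum.cong) (auto simp: algebra_simps)
  qed
  have "moment V t G (\<lambda>x. x u * x v)
      \<le> real s * (tanh \<Theta>)\<^sup>2 / (1 - (real s - 1) * tanh \<Theta>) * moment V t G (\<lambda>x. 1)"
    using J \<Theta>0 by (intro moment_nonadjacent_bound V \<Theta> G deg uv) (auto simp: t_def)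
  then have "(\<Prod>e\<in>G. cosh (J e)) * moment V t G (\<lambda>x. x u * x v) \<le> (\<Prod>e\<in>G. cosh (J e)) *
      (real s * (tanh \<Theta>)\<^sup>2 / (1 - (real s - 1) * tanh \<Theta>) * moment V t G (\<lambda>x. 1))"
    by (intro mult_left_mono prod_nonneg) auto
  then show ?thesis
    using eq[of "\<lambda>x. x u * x v"] eq[of "\<lambda>x. 1"] by (simp add: algebra_simps)
qed

section \<open>Hyperbolic inequalities\<close>

lemma cosh_le_cosh_abs:
  fixes x y :: real
  assumes "\<bar>x\<bar> \<le> \<bar>y\<bar>"
  shows "cosh x \<le> cosh y"
  using cosh_real_nonneg_le_iff[of "\<bar>x\<bar>" "\<bar>y\<bar>"] assms by (simp add: cosh_real_abs)

text \<open>
  If \<open>i\<close> of the \<open>s\<close> neighbours of \<open>u\<close> and \<open>j\<close> of the \<open>s\<close> neighbours of \<open>v\<close> carry the spin \<open>-1\<close>, then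
  \<open>h\<^sub>u + h\<^sub>v = 2 (s - i - j)\<close> and \<open>h\<^sub>v - h\<^sub>u = 2 (i - j)\<close>. Unless all spins are equal, the ratio of the
  two hyperbolic cosines is largest when a single spin deviates. For \<open>i = j\<close> the difference vanishes, but
  both spins occur at least twice, so the sum is at most \<open>2 (s - 2)\<close> in absolute value; the product formula for
  \<open>cosh\<close> shows that this outweighs the loss.
\<close>

lemma cosh_slot_inequality:
  fixes i j s :: nat and \<Theta> :: real
  assumes "\<Theta> \<ge> 0" "i \<le> s" "j \<le> s" "0 < i + j" "i + j < 2 * s"
  shows "cosh (2 * (real s - real i - real j) * \<Theta>) * cosh (2 * \<Theta>)
    \<le> cosh (2 * (real s - 1) * \<Theta>) * cosh (2 * (real i - real j) * \<Theta>)"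
proof (cases "i = j")
  case False
  have "\<bar>real s - real i - real j\<bar> \<le> \<bar>real s - 1\<bar>"
    using assms by linarith
  then have "\<bar>2 * (real s - real i - real j) * \<Theta>\<bar> \<le> \<bar>2 * (real s - 1) * \<Theta>\<bar>"
    unfolding abs_mult by (intro mult_right_mono mult_left_mono) auto
  moreover have "\<bar>2 * \<Theta>\<bar> \<le> \<bar>2 * (real i - real j) * \<Theta>\<bar>"
    unfolding abs_mult using assms False by (intro mult_right_mono) auto
  ultimately show ?thesis
    by (intro mult_mono cosh_le_cosh_abs) auto
next
  case True
  define a where "a = real s - real i - real j"
  have "1 \<le> j" "j + 1 \<le> s" using assms True by linarith+
  then have a: "\<bar>a\<bar> \<le> real s - 2" using True by (auto simp: a_def)
  have "cosh (2 * a * \<Theta>) * cosh (2 * \<Theta>) = (cosh (2 * (a + 1) * \<Theta>) + cosh (2 * (a - 1) * \<Theta>)) / 2"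
    using cosh_add[of "2 * a * \<Theta>" "2 * \<Theta>"] cosh_diff[of "2 * a * \<Theta>" "2 * \<Theta>"]
    by (simp add: algebra_simps)
  also have "\<dots> \<le> (cosh (2 * (real s - 1) * \<Theta>) + cosh (2 * (real s - 1) * \<Theta>)) / 2"
  proof (intro divide_right_mono add_mono cosh_le_cosh_abs)
    have "\<bar>a + 1\<bar> \<le> \<bar>real s - 1\<bar>" using a by linarith
    then show "\<bar>2 * (a + 1) * \<Theta>\<bar> \<le> \<bar>2 * (real s - 1) * \<Theta>\<bar>"
      unfolding abs_mult by (intro mult_right_mono mult_left_mono) auto
    have "\<bar>a - 1\<bar> \<le> \<bar>real s - 1\<bar>" using a by linarith
    then show "\<bar>2 * (a - 1) * \<Theta>\<bar> \<le> \<bar>2 * (real s - 1) * \<Theta>\<bar>"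
      unfolding abs_mult by (intro mult_right_mono mult_left_mono) auto
  qed auto
  finally show ?thesis using True by (simp add: a_def)
qed

text \<open>
  A lower bound for what the flip of one neighbour of a unanimous configuration contributes to the
  balance of odds, relative to the weight of that configuration.
\<close>

definition flip_gain :: "nat \<Rightarrow> real \<Rightarrow> real" where
  "flip_gain s \<Theta> = exp (- 2 * (real s - 1) * \<Theta>)
     * (R s \<Theta> * cosh (2 * \<Theta>) - cosh (2 * (real s - 1) * \<Theta>))"

lemma R_denominator_pos:
  "2 * real s * exp (- 2 * (real s - 1) * \<Theta>) * cosh (2 * \<Theta>) + 1 > 0"
  by (intro add_nonneg_pos mult_nonneg_nonneg) auto

lemma R_pos: "R s \<Theta> > 0"
  unfolding R_def
  by (intro divide_pos_pos R_denominator_pos add_pos_nonneg mult_nonneg_nonneg) auto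

text \<open>
  The equation that determines \<open>R\<close>: the deficit of a unanimous configuration equals the gain from
  \<open>2 s\<close> flips.
\<close>

lemma R_balance: "R s \<Theta> - cosh (2 * real s * \<Theta>) + 2 * real s * flip_gain s \<Theta> = 0"
proof -
  define q where "q = 2 * real s * exp (- 2 * (real s - 1) * \<Theta>)"
  have "q * cosh (2 * \<Theta>) + 1 > 0"
    using R_denominator_pos unfolding q_def .
  moreover have "R s \<Theta> = (cosh (2 * real s * \<Theta>) + q * cosh (2 * (real s - 1) * \<Theta>)) / (q * cosh (2 * \<Theta>) + 1)"
    unfolding R_def q_def ..
  ultimately have "R s \<Theta> * (q * cosh (2 * \<Theta>) + 1)
      = cosh (2 * real s * \<Theta>) + q * cosh (2 * (real s - 1) * \<Theta>)"
    by simp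
  then show ?thesis
    unfolding flip_gain_def q_def by (simp add: algebra_simps)
qed

text \<open>
  \<open>R\<close> is a weighted mean of \<open>cosh (2 s \<Theta>)\<close> and \<open>cosh (2 (s - 1) \<Theta>) / cosh (2 \<Theta>)\<close>, and the second
  of these is the smaller one.
\<close>

lemma flip_gain_nonneg:
  assumes "\<Theta> \<ge> 0" "s \<ge> 1"
  shows "flip_gain s \<Theta> \<ge> 0"
proof -
  define q where "q = 2 * real s * exp (- 2 * (real s - 1) * \<Theta>)"
  have "cosh (2 * real s * \<Theta>) * cosh (2 * \<Theta>)
      = cosh (2 * (real s - 1) * \<Theta>) + sinh (2 * real s * \<Theta>) * sinh (2 * \<Theta>)"
    using cosh_diff[of "2 * real s * \<Theta>" "2 * \<Theta>"] by (simp add: algebra_simps)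
  moreover have "sinh (2 * real s * \<Theta>) * sinh (2 * \<Theta>) \<ge> 0"
    using assms by (intro mult_nonneg_nonneg) auto
  ultimately have "cosh (2 * (real s - 1) * \<Theta>) * (q * cosh (2 * \<Theta>) + 1)
      \<le> (cosh (2 * real s * \<Theta>) + q * cosh (2 * (real s - 1) * \<Theta>)) * cosh (2 * \<Theta>)"
    by (simp add: algebra_simps)
  then have "cosh (2 * (real s - 1) * \<Theta>) \<le> R s \<Theta> * cosh (2 * \<Theta>)"
    using R_denominator_pos[of s \<Theta>] unfolding R_def q_def
    by (simp add: pos_le_divide_eq)
  then show ?thesis unfolding flip_gain_def by simp
qed

lemma R_slot_inequality:
  fixes i j s :: nat and \<Theta> :: real
  assumes "\<Theta> \<ge> 0" "i \<le> s" "j \<le> s" "0 < i + j" "i + j < 2 * s"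
  shows "cosh (2 * (real s - real i - real j) * \<Theta>) \<le> R s \<Theta> * cosh (2 * (real i - real j) * \<Theta>)"
proof -
  have s: "s \<ge> 1" using assms by simp
  have "cosh (2 * (real s - 1) * \<Theta>) \<le> R s \<Theta> * cosh (2 * \<Theta>)"
    using flip_gain_nonneg[OF assms(1) s] unfolding flip_gain_def
    by (simp add: zero_le_mult_iff)
  then have "cosh (2 * (real s - 1) * \<Theta>) * cosh (2 * (real i - real j) * \<Theta>)
      \<le> R s \<Theta> * cosh (2 * \<Theta>) * cosh (2 * (real i - real j) * \<Theta>)"
    by (intro mult_right_mono) auto
  from order.trans[OF cosh_slot_inequality[OF assms] this]
  have "cosh (2 * (real s - real i - real j) * \<Theta>) * cosh (2 * \<Theta>)
      \<le> R s \<Theta> * cosh (2 * (real i - real j) * \<Theta>) * cosh (2 * \<Theta>)"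
    by (simp only: mult_ac)
  then show ?thesis
    by (simp only: mult_le_cancel_right_pos[OF cosh_real_pos])
qed

text \<open>
  Flipping a common neighbour of \<open>u\<close> and \<open>v\<close> leaves \<open>h\<^sub>u = h\<^sub>v\<close> and affects at most \<open>s - 2\<close> other edges. In the
  variables \<open>z = exp (2 \<Theta>)\<close> and \<open>a = z\<^sup>s\<^sup>-\<^sup>2\<close> all quantities are rational, and the claim becomes an upper bound
  \<open>L\<close> for \<open>R\<close>. After clearing denominators it reads
  \<open>(z\<^sup>2 - 1) (s z\<^sup>2 (a\<^sup>2 - 1) - a (z\<^sup>2 - 1)) \<ge> 0\<close>, which holds because \<open>1 \<le> z \<le> a\<close> for \<open>s \<ge> 3\<close>.
\<close>

lemma shared_flip_gain:
  fixes \<Theta> :: real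
  assumes "\<Theta> \<ge> 0" "s \<ge> 3"
  shows "2 * flip_gain s \<Theta>
    \<le> exp (- 2 * (real s - 2) * \<Theta>) * (R s \<Theta> - cosh (2 * (real s - 2) * \<Theta>))"
proof -
  define z where "z = exp (2 * \<Theta>)"
  define a where "a = exp (2 * (real s - 2) * \<Theta>)"
  have z1: "z \<ge> 1" using assms by (simp add: z_def)
  have az: "z \<le> a"
    unfolding a_def z_def using assms mult_right_mono[of 2 "2 * (real s - 2)" \<Theta>] by simp
  have pos: "z > 0" "a > 0" by (auto simp: z_def a_def)
  have shifts: "exp (2 * real s * \<Theta>) = a * z\<^sup>2" "exp (2 * (real s - 1) * \<Theta>) = a * z"
    unfolding a_def z_def power2_eq_square exp_add[symmetric] by (simp_all add: algebra_simps)
  have inverses: "exp (- (2 * real s * \<Theta>)) = 1 / (a * z\<^sup>2)"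
    "exp (- (2 * (real s - 1) * \<Theta>)) = 1 / (a * z)"
    "exp (- (2 * (real s - 2) * \<Theta>)) = 1 / a" "exp (- (2 * \<Theta>)) = 1 / z"
    by (simp_all only: exp_minus shifts inverse_eq_divide a_def[symmetric] z_def[symmetric])
  have cosh_eqs: "cosh (2 * real s * \<Theta>) = (a * z\<^sup>2 + 1 / (a * z\<^sup>2)) / 2"
    "cosh (2 * (real s - 1) * \<Theta>) = (a * z + 1 / (a * z)) / 2"
    "cosh (2 * (real s - 2) * \<Theta>) = (a + 1 / a) / 2" "cosh (2 * \<Theta>) = (z + 1 / z) / 2"
    unfolding cosh_def inverses shifts by (simp_all add: a_def z_def)
  define S where "S = real s"
  have S: "S \<ge> 3" using assms by (simp add: S_def)
  define Num where "Num = (a * z\<^sup>2 + 1 / (a * z\<^sup>2)) / 2 + S * (1 + 1 / (a * z)\<^sup>2)"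
  define Den where "Den = S * (1 / a + 1 / (a * z\<^sup>2)) + 1"
  define L where "L = a * z\<^sup>2 / 2 + 1 / a - z\<^sup>2 / (2 * a)"
  have Den: "Den > 0" unfolding Den_def using pos S by (intro add_nonneg_pos mult_nonneg_nonneg) auto
  have e: "exp (- 2 * (real s - 1) * \<Theta>) = 1 / (a * z)" "exp (- 2 * (real s - 2) * \<Theta>) = 1 / a"
    using inverses(2,3) by (simp_all add: algebra_simps)
  have "R s \<Theta> = Num / Den"
    unfolding R_def e cosh_eqs Num_def Den_def S_def using pos
    by (intro arg_cong2[where f = "(/)"]) (auto simp: field_simps power2_eq_square)
  moreover have "Num \<le> L * Den"
  proof -
    have "2 * (L * Den - Num) * (a\<^sup>2 * z\<^sup>2) = (z\<^sup>2 - 1) * (S * (a\<^sup>2 * z\<^sup>2 - z\<^sup>2) - a * (z\<^sup>2 - 1))"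
      unfolding L_def Den_def Num_def using pos by (simp add: field_simps) algebra
    moreover have "(z\<^sup>2 - 1) * (S * (a\<^sup>2 * z\<^sup>2 - z\<^sup>2) - a * (z\<^sup>2 - 1)) \<ge> 0"
    proof -
      have "S * (a\<^sup>2 * z\<^sup>2 - z\<^sup>2) \<ge> 1 * (a\<^sup>2 * z\<^sup>2 - z\<^sup>2)"
        using S az z1 pos by (intro mult_right_mono) (auto simp: power_mono)
      \<comment> \<open>expansion around \<open>a = z\<close>, the case \<open>s = 3\<close>\<close>
      moreover have "a\<^sup>2 * z\<^sup>2 - z\<^sup>2 - a * (z\<^sup>2 - 1)
          = (a - z) * (z\<^sup>2 * (a + z - 1) + 1) + z * (z - 1) * (z\<^sup>2 - 1)"
        by algebra
      moreover have "\<dots> \<ge> 0"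
        using az z1 by (intro add_nonneg_nonneg mult_nonneg_nonneg) auto
      ultimately show ?thesis using z1 by (intro mult_nonneg_nonneg) auto
    qed
    ultimately have "0 \<le> 2 * (L * Den - Num) * (a\<^sup>2 * z\<^sup>2)"
      by simp
    moreover have "0 < a\<^sup>2 * z\<^sup>2" using pos by simp
    ultimately have "0 \<le> 2 * (L * Den - Num)"
      by (metis mult_le_cancel_right_pos mult_zero_left)
    then show ?thesis by simp
  qed
  ultimately have RL: "R s \<Theta> \<le> L"
    using Den by (simp add: pos_divide_le_eq)
  \<comment> \<open>\<open>R\<close> occurs with the coefficient \<open>1 / a - (z + 1 / z) / (a * z) = - 1 / (a * z\<^sup>2)\<close>.\<close>
  have "exp (- 2 * (real s - 2) * \<Theta>) * (R s \<Theta> - cosh (2 * (real s - 2) * \<Theta>)) - 2 * flip_gain s \<Theta>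
      = (L - R s \<Theta>) / (a * z\<^sup>2)"
    unfolding flip_gain_def cosh_eqs e L_def using pos by (simp add: field_simps) algebra
  also have "\<dots> \<ge> 0" using RL pos by simp
  finally show ?thesis by simp
qed

section \<open>Peierls-type comparison of configurations\<close>

definition flip :: "nat \<Rightarrow> (nat \<Rightarrow> real) \<Rightarrow> nat \<Rightarrow> real" where
  "flip w y = y(w := - y w)"

lemma flip_flip [simp]: "flip w (flip w y) = y"
  by (simp add: flip_def)

lemma flip_configs: "y \<in> configs V \<Longrightarrow> w \<in> V \<Longrightarrow> flip w y \<in> configs V"
  unfolding flip_def using configs_cases[of y V w] by (intro configs_upd) auto

lemma sum_flip:
  assumes "finite A"
  shows "(\<Sum>i\<in>A. flip w y i) = (\<Sum>i\<in>A. y i) - 2 * y w * of_bool (w \<in> A)"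
proof -
  have "(\<Sum>i\<in>A. flip w y i) = (\<Sum>i\<in>A. y i - (if i = w then 2 * y w else 0))"
    by (intro sum.cong) (auto simp: flip_def)
  then show ?thesis
    using assms by (simp add: sum_subtractf)
qed

lemma sum_signs_eq_card:
  fixes y :: "nat \<Rightarrow> real"
  assumes "finite A" "\<And>i. i \<in> A \<Longrightarrow> y i = 1 \<or> y i = -1"
  shows "(\<Sum>i\<in>A. y i) = real (card A) - 2 * real (card {i \<in> A. y i = -1})"
proof -
  have "(\<Sum>i\<in>A. y i) = (\<Sum>i\<in>A. 1 - 2 * of_bool (y i = -1))"
    using assms(2) by (intro sum.cong) force+
  also have "\<dots> = real (card A) - 2 * (\<Sum>i\<in>A. of_bool (y i = -1))"
    by (simp only: sum_subtractf sum_distrib_left) simp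
  also have "(\<Sum>i\<in>A. of_bool (y i = -1)) = real (card {i \<in> A. y i = -1})"
    using assms(1) by (simp add: Int_def)
  finally show ?thesis .
qed

definition agree :: "nat set \<Rightarrow> (nat \<Rightarrow> real) \<Rightarrow> bool" where
  "agree N y \<longleftrightarrow> (\<exists>\<sigma>. \<forall>w\<in>N. y w = \<sigma>)"

text \<open>
  One quarter of the contribution of \<open>y\<close> to the balance of odds, per unit of weight, after summing over the four
  values of the spins of two vertices with neighbourhoods \<open>A\<close> and \<open>B\<close>.
\<close>

definition odds_term :: "nat \<Rightarrow> real \<Rightarrow> nat set \<Rightarrow> nat set \<Rightarrow> (nat \<Rightarrow> real) \<Rightarrow> real" where
  "odds_term s \<Theta> A B y = R s \<Theta> * cosh (\<Theta> * ((\<Sum>i\<in>A. y i) - (\<Sum>i\<in>B. y i)))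
     - cosh (\<Theta> * ((\<Sum>i\<in>A. y i) + (\<Sum>i\<in>B. y i)))"

lemma odds_term_not_agree:
  assumes "finite V" "A \<subseteq> V" "B \<subseteq> V" "card A = s" "card B = s" "\<Theta> \<ge> 0"
    and y: "y \<in> configs V" "\<not> agree (A \<union> B) y"
  shows "odds_term s \<Theta> A B y \<ge> 0"
proof -
  have fin: "finite A" "finite B" using assms finite_subset by blast+
  define i where "i = card {w \<in> A. y w = -1}"
  define j where "j = card {w \<in> B. y w = -1}"
  have sign: "y w = 1 \<or> y w = -1" if "w \<in> A \<union> B" for w
    using configs_cases[OF y(1)] that assms(2,3) by blast
  have sums: "(\<Sum>w\<in>A. y w) = real s - 2 * real i" "(\<Sum>w\<in>B. y w) = real s - 2 * real j"
    using sum_signs_eq_card[OF fin(1), of y] sum_signs_eq_card[OF fin(2), of y] sign assms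
    by (auto simp: i_def j_def)
  have le: "i \<le> s" "j \<le> s"
    unfolding i_def j_def using assms(4,5) card_mono[OF fin(1), of "{w \<in> A. y w = -1}"]
      card_mono[OF fin(2), of "{w \<in> B. y w = -1}"] by auto
  have "0 < i + j"
  proof (rule ccontr)
    assume "\<not> 0 < i + j"
    then have "{w \<in> A. y w = -1} = {}" "{w \<in> B. y w = -1} = {}"
      using fin by (auto simp: i_def j_def)
    then have "\<forall>w\<in>A \<union> B. y w = 1" using sign by blast
    then show False using y(2) unfolding agree_def by blast
  qed
  moreover have "i + j < 2 * s"
  proof (rule ccontr)
    assume "\<not> i + j < 2 * s"
    then have "i = card A" "j = card B" using le assms by auto
    then have "{w \<in> A. y w = -1} = A" "{w \<in> B. y w = -1} = B"
      using card_subset_eq[OF fin(1), of "{w \<in> A. y w = -1}"]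
        card_subset_eq[OF fin(2), of "{w \<in> B. y w = -1}"] by (simp_all add: i_def j_def)
    then have "\<forall>w\<in>A \<union> B. y w = -1" by blast
    then show False using y(2) unfolding agree_def by blast
  qed
  ultimately have "cosh (2 * (real s - real i - real j) * \<Theta>)
      \<le> R s \<Theta> * cosh (2 * (real i - real j) * \<Theta>)"
    using R_slot_inequality assms(6) le by blast
  moreover have "cosh (\<Theta> * ((\<Sum>w\<in>A. y w) - (\<Sum>w\<in>B. y w))) = cosh (2 * (real i - real j) * \<Theta>)"
    unfolding sums cosh_minus[of "2 * (real i - real j) * \<Theta>", symmetric] by (simp add: algebra_simps)
  moreover have "\<Theta> * ((\<Sum>w\<in>A. y w) + (\<Sum>w\<in>B. y w)) = 2 * (real s - real i - real j) * \<Theta>"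
    unfolding sums by (simp add: algebra_simps)
  ultimately show ?thesis unfolding odds_term_def by (simp only: diff_ge_0_iff_ge)
qed

lemma cosh_sign_mult:
  assumes "\<sigma> = 1 \<or> \<sigma> = (-1 :: real)"
  shows "cosh (\<sigma> * c) = cosh c"
  using assms by auto

lemma odds_term_sums:
  assumes "\<sigma> = 1 \<or> \<sigma> = (-1 :: real)"
    and "(\<Sum>i\<in>A. y i) = \<sigma> * a" "(\<Sum>i\<in>B. y i) = \<sigma> * b"
  shows "odds_term s \<Theta> A B y = R s \<Theta> * cosh (\<Theta> * (a - b)) - cosh (\<Theta> * (a + b))"
proof -
  have "\<Theta> * (\<sigma> * a - \<sigma> * b) = \<sigma> * (\<Theta> * (a - b))" "\<Theta> * (\<sigma> * a + \<sigma> * b) = \<sigma> * (\<Theta> * (a + b))"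
    by (simp_all add: algebra_simps)
  then show ?thesis
    unfolding odds_term_def assms(2,3) by (simp only: cosh_sign_mult[OF assms(1)])
qed

text \<open>
  A flipped neighbour counts with its multiplicity, that is, twice if it is common to both
  neighbourhoods.
\<close>

lemma odds_term_flip:
  fixes \<mu> :: "(nat \<Rightarrow> real) \<Rightarrow> real"
  assumes V: "finite V" "A \<subseteq> V" "B \<subseteq> V" "card A = s" "card B = s" and s: "s \<ge> 3" and \<Theta>: "\<Theta> \<ge> 0"
    and y: "y \<in> configs V" "agree (A \<union> B) y" and w: "w \<in> A \<union> B" and \<mu>: "\<mu> y \<ge> 0"
    and flip: "\<mu> (flip w y)
      \<ge> exp (- 2 * (real s - of_bool (w \<in> A) - of_bool (w \<in> B)) * \<Theta>) * \<mu> y"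
  shows "\<mu> (flip w y) * odds_term s \<Theta> A B (flip w y)
    \<ge> (of_bool (w \<in> A) + of_bool (w \<in> B)) * flip_gain s \<Theta> * \<mu> y"
proof -
  have fin: "finite A" "finite B" using V finite_subset by blast+
  obtain \<sigma> where \<sigma>: "\<forall>w\<in>A \<union> B. y w = \<sigma>" using y(2) unfolding agree_def by blast
  have sign: "\<sigma> = 1 \<or> \<sigma> = -1" using \<sigma> w configs_cases[OF y(1), of w] V by auto
  have yw: "y w = \<sigma>" using \<sigma> w by blast
  have sums: "(\<Sum>i\<in>A. flip w y i) = \<sigma> * (real s - 2 * of_bool (w \<in> A))"
    "(\<Sum>i\<in>B. flip w y i) = \<sigma> * (real s - 2 * of_bool (w \<in> B))"
    using \<sigma> V unfolding sum_flip[OF fin(1)] sum_flip[OF fin(2)] yw by (simp_all add: algebra_simps)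
  note odds_term_eq = odds_term_sums[OF sign sums, of s \<Theta>]
  show ?thesis
  proof (cases "w \<in> A \<and> w \<in> B")
    case True
    have "odds_term s \<Theta> A B (flip w y) = R s \<Theta> - cosh (2 * (real s - 2) * \<Theta>)"
      using True unfolding odds_term_eq by (simp add: algebra_simps)
    moreover have "R s \<Theta> - cosh (2 * (real s - 2) * \<Theta>) \<ge> 0"
      using R_slot_inequality[OF \<Theta>, of 1 s 1] s by (simp add: algebra_simps)
    moreover have "\<mu> (flip w y) \<ge> exp (- 2 * (real s - 2) * \<Theta>) * \<mu> y"
      using flip True by simp
    ultimately have "\<mu> (flip w y) * odds_term s \<Theta> A B (flip w y)
        \<ge> exp (- 2 * (real s - 2) * \<Theta>) * \<mu> y * (R s \<Theta> - cosh (2 * (real s - 2) * \<Theta>))"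
      by (simp add: mult_right_mono)
    moreover have "2 * flip_gain s \<Theta> * \<mu> y
        \<le> exp (- 2 * (real s - 2) * \<Theta>) * (R s \<Theta> - cosh (2 * (real s - 2) * \<Theta>)) * \<mu> y"
      using shared_flip_gain[OF \<Theta> s] \<mu> by (intro mult_right_mono)
    ultimately show ?thesis using True by (simp add: mult_ac)
  next
    case False
    have "odds_term s \<Theta> A B (flip w y) = R s \<Theta> * cosh (2 * \<Theta>) - cosh (2 * (real s - 1) * \<Theta>)"
      using w False unfolding odds_term_eq cosh_minus[of "2 * \<Theta>", symmetric]
      by (auto simp: algebra_simps)
    moreover have "R s \<Theta> * cosh (2 * \<Theta>) - cosh (2 * (real s - 1) * \<Theta>) \<ge> 0"
      using R_slot_inequality[OF \<Theta>, of 1 s 0] s by (simp add: algebra_simps)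
    moreover have "\<mu> (flip w y) \<ge> exp (- 2 * (real s - 1) * \<Theta>) * \<mu> y"
      using flip w False by auto
    ultimately have "\<mu> (flip w y) * odds_term s \<Theta> A B (flip w y) \<ge> exp (- 2 * (real s - 1) * \<Theta>) * \<mu> y
        * (R s \<Theta> * cosh (2 * \<Theta>) - cosh (2 * (real s - 1) * \<Theta>))"
      by (simp add: mult_right_mono)
    then have "\<mu> (flip w y) * odds_term s \<Theta> A B (flip w y) \<ge> flip_gain s \<Theta> * \<mu> y"
      unfolding flip_gain_def by (simp add: mult_ac)
    moreover have "(of_bool (w \<in> A) + of_bool (w \<in> B) :: real) = 1" using w False by auto
    ultimately show ?thesis by simp
  qed
qed

lemma not_agree_flip:
  assumes "y \<in> configs V" "N \<subseteq> V" "card N \<ge> 2" "agree N y" "w \<in> N"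
  shows "\<not> agree N (flip w y)"
proof
  assume "agree N (flip w y)"
  have "N \<noteq> {w}" using assms(3) by auto
  then obtain t where t: "t \<in> N" "t \<noteq> w" using assms(5) by blast
  have "flip w y t = flip w y w" "y t = y w"
    using \<open>agree N (flip w y)\<close> assms(4,5) t unfolding agree_def by metis+
  then show False
    using t configs_cases[OF assms(1), of w] assms(2,5) by (auto simp: flip_def)
qed

text \<open>
  With three sites or more, the flipped site is the one that disagrees with the majority, so
  the unanimous configuration can be recovered. Two sites would not suffice: flipping the first one of
  \<open>(1, 1)\<close> and the second one of \<open>(-1, -1)\<close> gives the same result.
\<close>

lemma inj_on_flip:
  assumes "N \<subseteq> V" "card N \<ge> 3"
  shows "inj_on (\<lambda>(y, w). flip w y) ({y \<in> configs V. agree N y} \<times> N)"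
proof -
  have eq: "w = w'" if y: "y \<in> configs V" "agree N y" "agree N y'"
    and w: "w \<in> N" "w' \<in> N" "flip w y = flip w' y'" for y y' w w'
  proof (rule ccontr)
    assume ne: "w \<noteq> w'"
    have "\<not> N \<subseteq> {w, w'}"
      using assms(2) card_mono[of "{w, w'}" N] ne by auto
    then obtain t where t: "t \<in> N" "t \<noteq> w" "t \<noteq> w'" by blast
    have "y t = y' t" "- y w = y' w"
      using fun_cong[OF w(3), of t] fun_cong[OF w(3), of w] t ne by (auto simp: flip_def)
    moreover have "y t = y w" "y' t = y' w"
      using y t w unfolding agree_def by metis+
    ultimately show False using configs_cases[OF y(1), of w] w assms(1) by auto
  qed
  have "y = y' \<and> w = w'" if "y \<in> configs V" "agree N y" "agree N y'"
    "w \<in> N" "w' \<in> N" "flip w y = flip w' y'" for y y' w w'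
    using eq[OF that] that(6) flip_flip by metis
  then show ?thesis unfolding inj_on_def by auto
qed

text \<open>
  Unanimous configurations are grouped with their flips; by \<open>inj_on_flip\<close> the groups are disjoint. Every
  group has a nonnegative sum by \<open>R_balance\<close>, since the multiplicities add up to \<open>2 s\<close>, and
  the configurations outside all groups contribute nonnegative terms.
\<close>

lemma sum_odds_term_nonneg:
  fixes \<mu> :: "(nat \<Rightarrow> real) \<Rightarrow> real"
  assumes V: "finite V" "A \<subseteq> V" "B \<subseteq> V" "card A = s" "card B = s" and s: "s \<ge> 3" and \<Theta>: "\<Theta> \<ge> 0"
    and \<mu>: "\<And>y. \<mu> y \<ge> 0"
    and flip: "\<And>y w. y \<in> configs V \<Longrightarrow> w \<in> A \<union> B \<Longrightarrow> \<mu> (flip w y)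
      \<ge> exp (- 2 * (real s - of_bool (w \<in> A) - of_bool (w \<in> B)) * \<Theta>) * \<mu> y"
  shows "(\<Sum>y\<in>configs V. \<mu> y * odds_term s \<Theta> A B y) \<ge> 0"
proof -
  define N where "N = A \<union> B"
  define C where "C = {y \<in> configs V. agree N y}"
  define T where "T y = \<mu> y * odds_term s \<Theta> A B y" for y
  have fin: "finite A" "finite B" using V finite_subset by blast+
  have N: "N \<subseteq> V" "card N \<ge> 3" "finite N"
    using V s fin card_mono[of N A] by (auto simp: N_def)
  have C: "C \<subseteq> configs V" "finite C" using finite_configs[OF V(1)] by (auto simp: C_def)
  let ?F = "(\<lambda>(y, w). flip w y) ` (C \<times> N)"
  have F: "?F \<subseteq> configs V" "?F \<inter> C = {}"
    using flip_configs N not_agree_flip[of _ V N] by (auto simp: C_def)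
  have nonneg: "T y \<ge> 0" if "y \<in> configs V - C" for y
    unfolding T_def using that odds_term_not_agree[OF V \<Theta>, of y] \<mu> by (auto simp: C_def N_def)
  have cluster: "T y + (\<Sum>w\<in>N. T (flip w y)) \<ge> 0" if y: "y \<in> C" for y
  proof -
    have yV: "y \<in> configs V" and ag: "agree (A \<union> B) y" using y by (auto simp: C_def N_def)
    obtain \<sigma> where \<sigma>: "\<forall>w\<in>A \<union> B. y w = \<sigma>" using ag unfolding agree_def by blast
    obtain a where "a \<in> A" using V(4) s by fastforce
    then have sign: "\<sigma> = 1 \<or> \<sigma> = -1" using \<sigma> configs_cases[OF yV, of a] V by auto
    have odds: "odds_term s \<Theta> A B y = R s \<Theta> * cosh (\<Theta> * (real s - real s)) - cosh (\<Theta> * (real s + real s))"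
      using \<sigma> V by (intro odds_term_sums[OF sign]) auto
    have T: "T y = \<mu> y * (R s \<Theta> - cosh (2 * real s * \<Theta>))"
      unfolding T_def odds by (simp add: algebra_simps)
    have "(\<Sum>w\<in>N. T (flip w y)) \<ge> (\<Sum>w\<in>N. (of_bool (w \<in> A) + of_bool (w \<in> B)) * (flip_gain s \<Theta> * \<mu> y))"
      unfolding T_def N_def mult.assoc[symmetric]
      using yV ag \<mu> flip by (intro sum_mono odds_term_flip[OF V s \<Theta>]) auto
    also have "(\<Sum>w\<in>N. (of_bool (w \<in> A) + of_bool (w \<in> B)) * (flip_gain s \<Theta> * \<mu> y))
        = (\<Sum>w\<in>N. of_bool (w \<in> A) + of_bool (w \<in> B)) * (flip_gain s \<Theta> * \<mu> y)"
      by (rule sum_distrib_right[symmetric])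
    also have "(\<Sum>w\<in>N. of_bool (w \<in> A) + of_bool (w \<in> B)) = real (card A) + real (card B)"
    proof -
      have "N \<inter> A = A" "N \<inter> B = B" by (auto simp: N_def)
      then show ?thesis using N(3) by (simp add: sum.distrib)
    qed
    finally have "(\<Sum>w\<in>N. T (flip w y)) \<ge> 2 * real s * flip_gain s \<Theta> * \<mu> y"
      using V by (simp add: mult.assoc)
    then have "T y + (\<Sum>w\<in>N. T (flip w y))
        \<ge> (R s \<Theta> - cosh (2 * real s * \<Theta>) + 2 * real s * flip_gain s \<Theta>) * \<mu> y"
      unfolding T by (simp add: algebra_simps)
    then show ?thesis unfolding R_balance by simp
  qed
  have "0 \<le> (\<Sum>y\<in>C. T y + (\<Sum>w\<in>N. T (flip w y)))"
    using cluster by (intro sum_nonneg)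
  also have "\<dots> = (\<Sum>y\<in>C. T y) + (\<Sum>(y, w)\<in>C \<times> N. T (flip w y))"
    by (simp add: sum.distrib sum.cartesian_product)
  also have "(\<Sum>(y, w)\<in>C \<times> N. T (flip w y)) = (\<Sum>z\<in>?F. T z)"
    using inj_on_flip[OF N(1,2)] unfolding C_def[symmetric]
    by (subst sum.reindex) (auto simp: case_prod_unfold)
  also have "(\<Sum>y\<in>C. T y) + (\<Sum>z\<in>?F. T z) = (\<Sum>z\<in>C \<union> ?F. T z)"
    using C F N(3) by (intro sum.union_disjoint[symmetric]) auto
  also have "\<dots> \<le> (\<Sum>z\<in>configs V. T z)"
    using C F nonneg finite_configs[OF V(1)] by (intro sum_mono2) auto
  finally show ?thesis unfolding T_def .
qed

section \<open>Odds of agreement under uniform weights\<close>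

text \<open>
  A pair of equal spins has the coefficient \<open>-2\<close> and a pair of opposite spins the coefficient \<open>2 R\<close>, so
  this is nonnegative if and only if the odds of \<open>x\<^sub>u = x\<^sub>v\<close> are at most \<open>R s \<Theta>\<close>.
\<close>

definition odds_sum :: "nat set \<Rightarrow> nat \<Rightarrow> real \<Rightarrow> nat \<Rightarrow> nat \<Rightarrow> nat set set \<Rightarrow> real" where
  "odds_sum V s \<Theta> u v G = (\<Sum>x\<in>configs V.
     (R s \<Theta> - 1 - (R s \<Theta> + 1) * (x u * x v)) * exp (\<Theta> * (\<Sum>e\<in>G. edge_spin x e)))"

lemma edge_spin_upd_notin: "w \<notin> e \<Longrightarrow> edge_spin (x(w := a)) e = edge_spin x e"
  by (intro prod.cong) auto

lemma edge_spin_flip: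
  assumes "simple_graph V G" "e \<in> G"
  shows "edge_spin (flip w x) e = edge_spin x e - 2 * (if w \<in> e then edge_spin x e else 0)"
proof -
  obtain a b where "a \<noteq> b" "e = {a, b}" using assms unfolding simple_graph_def by blast
  then show ?thesis by (auto simp: flip_def)
qed

lemma star_sum:
  assumes "simple_graph V G"
  shows "(\<Sum>e | e \<in> G \<and> w \<in> e. edge_spin x e) = x w * (\<Sum>z\<in>nbrs G w. x z)"
proof -
  have "w \<noteq> z" if "z \<in> nbrs G w" for z
    using simple_graph_edgeD(3)[OF assms] that by (auto simp: nbrs_def)
  then show ?thesis
    unfolding star_eq[OF assms] sum_distrib_left by (subst sum.reindex[OF inj_star]) auto
qed

lemma simple_graph_mono: "simple_graph V G \<Longrightarrow> V \<subseteq> W \<Longrightarrow> simple_graph W G"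
  unfolding simple_graph_def by (meson subsetD)

lemma simple_graph_insert_edge:
  assumes "simple_graph V G" "a \<in> V" "b \<in> V" "a \<noteq> b"
  shows "simple_graph V (insert {a, b} G)"
  unfolding simple_graph_def
proof
  fix e assume "e \<in> insert {a, b} G"
  then consider "e = {a, b}" | "e \<in> G" by blast
  then show "\<exists>a\<in>V. \<exists>b\<in>V. a \<noteq> b \<and> e = {a, b}"
    by cases (use assms in \<open>auto simp: simple_graph_def\<close>)
qed

lemma degree_insert:
  assumes "finite G" "e \<notin> G"
  shows "degree (insert e G) i = degree G i + of_bool (i \<in> e)"
proof -
  have "{e' \<in> insert e G. i \<in> e'} = (if i \<in> e then insert e {e' \<in> G. i \<in> e'} else {e' \<in> G. i \<in> e'})"
    by auto
  then show ?thesis unfolding degree_def using assms by simp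
qed

text \<open>
  The edges from \<open>w\<close> to \<open>u\<close> and \<open>v\<close> are lost when these two vertices are removed. This is why a common
  neighbour is cheaper to flip.
\<close>

lemma degree_remove_pair:
  assumes "finite G" "u \<noteq> v" "w \<noteq> u" "w \<noteq> v"
  shows "degree {e \<in> G. u \<notin> e \<and> v \<notin> e} w + of_bool (w \<in> nbrs G u) + of_bool (w \<in> nbrs G v)
    \<le> degree G w"
proof -
  define G0 where "G0 = {e \<in> G. u \<notin> e \<and> v \<notin> e}"
  define Eu where "Eu = (if w \<in> nbrs G u then {{u, w}} else {})"
  define Ev where "Ev = (if w \<in> nbrs G v then {{v, w}} else {})"
  have "finite G0" using assms by (simp add: G0_def)
  have disj: "Eu \<inter> Ev = {}" "G0 \<inter> Eu = {}" "G0 \<inter> Ev = {}"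
    using assms by (auto simp: Eu_def Ev_def G0_def doubleton_eq_iff)
  have "degree G0 w + of_bool (w \<in> nbrs G u) + of_bool (w \<in> nbrs G v)
      = card {e \<in> G0. w \<in> e} + card Eu + card Ev"
    by (simp add: degree_def Eu_def Ev_def)
  also have "\<dots> = card ({e \<in> G0. w \<in> e} \<union> Eu \<union> Ev)"
    using disj \<open>finite G0\<close> by (subst card_Un_disjoint, (auto simp: Eu_def Ev_def)[3])+ auto
  also have "\<dots> \<le> card {e \<in> G. w \<in> e}"
    using assms(1) by (intro card_mono) (auto simp: G0_def Eu_def Ev_def nbrs_def split: if_splits)
  finally show ?thesis unfolding degree_def G0_def .
qed

text \<open>
  Removing \<open>u\<close> and \<open>v\<close> leaves an Ising model with weight \<open>\<mu>\<close>, in which flipping a spin changes the energy by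
  at most twice the remaining degree of its vertex.
\<close>

lemma odds_sum_full_degree:
  assumes V: "finite V" "u \<in> V" "v \<in> V" "u \<noteq> v" and G: "simple_graph V G" "{u, v} \<notin> G"
    and deg: "degree G u = s" "degree G v = s" "\<And>i. i \<in> V \<Longrightarrow> degree G i \<le> s"
    and s: "s \<ge> 3" and \<Theta>: "\<Theta> \<ge> 0"
  shows "odds_sum V s \<Theta> u v G \<ge> 0"
proof -
  define V0 where "V0 = V - {u, v}"
  define G0 where "G0 = {e \<in> G. u \<notin> e \<and> v \<notin> e}"
  define \<mu> where "\<mu> y = exp (\<Theta> * (\<Sum>e\<in>G0. edge_spin y e))" for y
  let ?A = "nbrs G u" and ?B = "nbrs G v"
  have V_eq: "V = insert u (insert v V0)" and V0: "finite V0" "u \<notin> V0" "v \<notin> V0"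
    using V by (auto simp: V0_def)
  have finG: "finite G" using simple_graph_finite V G by blast
  have "u \<notin> ?A" "v \<notin> ?B"
    using simple_graph_edgeD(3)[OF G(1), of u u] simple_graph_edgeD(3)[OF G(1), of v v]
    by (auto simp: nbrs_def)
  moreover have "v \<notin> ?A" "u \<notin> ?B"
    using G(2) by (simp_all add: nbrs_def insert_commute)
  ultimately have AB: "?A \<subseteq> V0" "?B \<subseteq> V0" "card ?A = s" "card ?B = s"
    using nbrs_subset[OF G(1)] card_nbrs[OF G(1)] deg(1,2) by (auto simp: V0_def)
  have G0: "simple_graph V0 G0"
    using G(1) unfolding simple_graph_def G0_def V0_def by fastforce
  have energy: "(\<Sum>e\<in>G. edge_spin (y(v := b, u := a)) e)
      = (\<Sum>e\<in>G0. edge_spin y e) + a * (\<Sum>i\<in>?A. y i) + b * (\<Sum>i\<in>?B. y i)" for y a b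
  proof -
    let ?x = "y(v := b, u := a)"
    have split: "G = G0 \<union> ({e \<in> G. u \<in> e} \<union> {e \<in> G. v \<in> e})" by (auto simp: G0_def)
    have disj: "{e \<in> G. u \<in> e} \<inter> {e \<in> G. v \<in> e} = {}"
    proof -
      have False if e: "e \<in> G" "u \<in> e" "v \<in> e" for e
      proof -
        obtain a b where "e = {a, b}" using G(1) e(1) unfolding simple_graph_def by blast
        then have "e = {u, v}" using e V(4) by auto
        then show False using e G(2) by simp
      qed
      then show ?thesis by blast
    qed
    have "(\<Sum>e\<in>G. edge_spin ?x e) = (\<Sum>e\<in>G0. edge_spin ?x e)
        + ((\<Sum>e | e \<in> G \<and> u \<in> e. edge_spin ?x e) + (\<Sum>e | e \<in> G \<and> v \<in> e. edge_spin ?x e))"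
      using finG disj
      by (subst split, subst sum.union_disjoint, (auto simp: G0_def)[3], subst sum.union_disjoint) auto
    also have "(\<Sum>e\<in>G0. edge_spin ?x e) = (\<Sum>e\<in>G0. edge_spin y e)"
      by (intro sum.cong) (simp_all add: G0_def edge_spin_upd_notin del: fun_upd_apply)
    also have "(\<Sum>e | e \<in> G \<and> u \<in> e. edge_spin ?x e) = a * (\<Sum>i\<in>?A. y i)"
    proof -
      have "(\<Sum>i\<in>?A. ?x i) = (\<Sum>i\<in>?A. y i)" using AB V0 by (intro sum.cong) auto
      then show ?thesis unfolding star_sum[OF G(1)] by simp
    qed
    also have "(\<Sum>e | e \<in> G \<and> v \<in> e. edge_spin ?x e) = b * (\<Sum>i\<in>?B. y i)"
    proof -
      have "(\<Sum>i\<in>?B. ?x i) = (\<Sum>i\<in>?B. y i)" using AB V0 by (intro sum.cong) auto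
      then show ?thesis unfolding star_sum[OF G(1)] using V(4) by simp
    qed
    finally show ?thesis by (simp only: add.assoc)
  qed
  have flip: "exp (- 2 * (real s - of_bool (w \<in> ?A) - of_bool (w \<in> ?B)) * \<Theta>) * \<mu> y \<le> \<mu> (flip w y)"
    if y: "y \<in> configs V0" and w: "w \<in> ?A \<union> ?B" for y w
  proof -
    have wV: "w \<in> V" "w \<noteq> u" "w \<noteq> v" using w AB by (auto simp: V0_def)
    have "degree G0 w + of_bool (w \<in> ?A) + of_bool (w \<in> ?B) \<le> s"
      using degree_remove_pair[OF finG V(4) wV(2,3)] deg(3)[OF wV(1)] unfolding G0_def by linarith
    then have "real (degree G0 w + of_bool (w \<in> ?A) + of_bool (w \<in> ?B)) \<le> real s"
      by (simp only: of_nat_le_iff)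
    then have degree: "real (degree G0 w) \<le> real s - of_bool (w \<in> ?A) - of_bool (w \<in> ?B)"
      by simp
    have "(\<Sum>e\<in>G0. edge_spin (flip w y) e)
        = (\<Sum>e\<in>G0. edge_spin y e - 2 * (if w \<in> e then edge_spin y e else 0))"
      by (intro sum.cong edge_spin_flip[OF G0] refl)
    also have "\<dots> = (\<Sum>e\<in>G0. edge_spin y e) - 2 * (\<Sum>e | e \<in> G0 \<and> w \<in> e. edge_spin y e)"
      using simple_graph_finite[OF V0(1) G0] unfolding sum_subtractf sum_distrib_left[symmetric]
      by (simp add: sum.inter_filter)
    also have "\<dots> \<ge> (\<Sum>e\<in>G0. edge_spin y e) - 2 * real (degree G0 w)"
    proof -
      have "(\<Sum>e | e \<in> G0 \<and> w \<in> e. edge_spin y e) \<le> (\<Sum>e | e \<in> G0 \<and> w \<in> e. 1)"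
        using edge_spin_config[OF y G0] by (intro sum_mono) force
      then show ?thesis by (simp add: degree_def)
    qed
    finally have "(\<Sum>e\<in>G0. edge_spin y e) - 2 * real (degree G0 w) \<le> (\<Sum>e\<in>G0. edge_spin (flip w y) e)" .
    then have "(\<Sum>e\<in>G0. edge_spin y e) - 2 * (real s - of_bool (w \<in> ?A) - of_bool (w \<in> ?B))
        \<le> (\<Sum>e\<in>G0. edge_spin (flip w y) e)"
      by (rule order.trans[rotated]) (use degree in \<open>intro diff_left_mono mult_left_mono, auto\<close>)
    then have "\<Theta> * ((\<Sum>e\<in>G0. edge_spin y e) - 2 * (real s - of_bool (w \<in> ?A) - of_bool (w \<in> ?B)))
        \<le> \<Theta> * (\<Sum>e\<in>G0. edge_spin (flip w y) e)"
      using \<Theta> by (intro mult_left_mono)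
    then show ?thesis
      unfolding \<mu>_def exp_add[symmetric] exp_le_cancel_iff by (simp add: algebra_simps)
  qed
  have "odds_sum V s \<Theta> u v G = (\<Sum>y\<in>configs V0. 4 * (\<mu> y * odds_term s \<Theta> ?A ?B y))"
  proof -
    define f where "f x = (R s \<Theta> - 1 - (R s \<Theta> + 1) * (x u * x v)) * exp (\<Theta> * (\<Sum>e\<in>G. edge_spin x e))"
      for x :: "nat \<Rightarrow> real"
    have f: "f (y(v := b, u := a)) = (R s \<Theta> - 1 - (R s \<Theta> + 1) * (a * b))
        * (\<mu> y * exp (\<Theta> * (a * (\<Sum>i\<in>?A. y i) + b * (\<Sum>i\<in>?B. y i))))" for y a b
      unfolding f_def energy \<mu>_def exp_add[symmetric] using V(4) by (simp add: algebra_simps)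
    have "odds_sum V s \<Theta> u v G = (\<Sum>y\<in>configs V0.
        (f (y(v := 1, u := 1)) + f (y(v := 1, u := -1))) + (f (y(v := -1, u := 1)) + f (y(v := -1, u := -1))))"
      unfolding odds_sum_def f_def[symmetric] V_eq using V0 V(4)
      by (simp add: sum_configs_insert del: fun_upd_apply)
    also have "\<dots> = (\<Sum>y\<in>configs V0. 4 * (\<mu> y * odds_term s \<Theta> ?A ?B y))"
    proof (intro sum.cong refl)
      fix y
      show "(f (y(v := 1, u := 1)) + f (y(v := 1, u := -1)))
          + (f (y(v := -1, u := 1)) + f (y(v := -1, u := -1))) = 4 * (\<mu> y * odds_term s \<Theta> ?A ?B y)"
        unfolding f odds_term_def cosh_def by (simp add: algebra_simps)
    qed
    finally show ?thesis .
  qed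
  also have "\<dots> \<ge> 0"
    unfolding sum_distrib_left[symmetric]
    using sum_odds_term_nonneg[OF V0(1) AB s \<Theta>, of \<mu>] flip by (simp add: \<mu>_def)
  finally show ?thesis .
qed

text \<open>
  The spin of a pendant vertex can be summed out; whatever the spin of its neighbour, this gives the factor
  \<open>2 cosh \<Theta>\<close>.
\<close>

lemma odds_sum_pendant:
  assumes V: "finite V" "u \<in> V" "v \<in> V" "c \<in> V" "p \<notin> V" and G: "simple_graph V G"
  shows "odds_sum (insert p V) s \<Theta> u v (insert {c, p} G) = 2 * cosh \<Theta> * odds_sum V s \<Theta> u v G"
proof -
  have notin: "p \<notin> e" if "e \<in> G" for e
    using bspec[OF G[unfolded simple_graph_def] that] V(5) by auto
  have ne: "u \<noteq> p" "v \<noteq> p" "c \<noteq> p" using V by auto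
  have energy: "(\<Sum>e\<in>insert {c, p} G. edge_spin (y(p := a)) e) = y c * a + (\<Sum>e\<in>G. edge_spin y e)" for y a
  proof -
    have "(\<Sum>e\<in>G. edge_spin (y(p := a)) e) = (\<Sum>e\<in>G. edge_spin y e)"
      by (intro sum.cong edge_spin_upd_notin notin) auto
    moreover have "edge_spin (y(p := a)) {c, p} = y c * a" using ne by simp
    moreover have "{c, p} \<notin> G" using notin by blast
    ultimately show ?thesis
      using simple_graph_finite[OF V(1) G] by (simp del: fun_upd_apply)
  qed
  have half: "exp (\<Theta> * (y c * 1)) + exp (\<Theta> * (y c * -1)) = 2 * cosh \<Theta>" if "y \<in> configs V" for y
    using configs_cases[OF that V(4)] by (auto simp: cosh_def)
  show ?thesis
    unfolding odds_sum_def sum_configs_insert[OF V(1,5)] energy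
  proof (subst sum_distrib_left, intro sum.cong refl)
    fix y assume y: "y \<in> configs V"
    have "E * exp (\<Theta> * (y c * 1 + S)) + E * exp (\<Theta> * (y c * -1 + S)) = 2 * cosh \<Theta> * (E * exp (\<Theta> * S))"
      for E S
      unfolding half[OF y, symmetric] distrib_left exp_add by (simp add: algebra_simps)
    then show "(R s \<Theta> - 1 - (R s \<Theta> + 1) * ((y(p := 1)) u * (y(p := 1)) v)) * exp (\<Theta> * (y c * 1 + (\<Sum>e\<in>G. edge_spin y e)))
        + (R s \<Theta> - 1 - (R s \<Theta> + 1) * ((y(p := -1)) u * (y(p := -1)) v)) * exp (\<Theta> * (y c * -1 + (\<Sum>e\<in>G. edge_spin y e)))
        = 2 * cosh \<Theta> * ((R s \<Theta> - 1 - (R s \<Theta> + 1) * (y u * y v)) * exp (\<Theta> * (\<Sum>e\<in>G. edge_spin y e)))"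
      using ne by simp
  qed
qed

text \<open>
  Pendant vertices are attached to \<open>u\<close> and \<open>v\<close> until both have degree \<open>s\<close>.
\<close>

lemma odds_sum_nonneg:
  assumes "finite V" "u \<in> V" "v \<in> V" "u \<noteq> v" "simple_graph V G" "{u, v} \<notin> G"
    and "\<And>i. i \<in> V \<Longrightarrow> degree G i \<le> s"
    and s: "s \<ge> 3" and \<Theta>: "\<Theta> \<ge> 0"
  shows "odds_sum V s \<Theta> u v G \<ge> 0"
  using assms(1-7)
proof (induction "(s - degree G u) + (s - degree G v)" arbitrary: V G rule: less_induct)
  case less
  note V = less.prems(1-4) and G = less.prems(5,6) and deg = less.prems(7)
  have finG: "finite G" using simple_graph_finite V G by blast
  show ?case
  proof (cases "degree G u = s \<and> degree G v = s")
    case True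
    then show ?thesis using odds_sum_full_degree V G deg s \<Theta> by blast
  next
    case False
    then obtain c where c: "c \<in> {u, v}" "degree G c < s"
      using deg V by (metis insertCI le_neq_implies_less)
    then have cV: "c \<in> V" using V by auto
    obtain p where p: "p \<notin> V" using V(1) ex_new_if_finite infinite_UNIV_nat by blast
    let ?G = "insert {c, p} G"
    have new: "{c, p} \<notin> G" using simple_graph_edgeD(2)[OF G(1)] p by blast
    have deg': "degree ?G i = degree G i + of_bool (i \<in> {c, p})" for i
      by (rule degree_insert[OF finG new])
    have "{e \<in> G. p \<in> e} = {}" using G(1) p unfolding simple_graph_def by auto
    then have degp: "degree G p = 0" by (simp only: degree_def card.empty)
    have "odds_sum (insert p V) s \<Theta> u v ?G \<ge> 0"
    proof (rule less.hyps)
      have le: "degree G u \<le> s" "degree G v \<le> s" using deg V by auto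
      have "c \<noteq> p" "u \<noteq> p" "v \<noteq> p" using V p cV by auto
      then show "s - degree ?G u + (s - degree ?G v) < s - degree G u + (s - degree G v)"
        unfolding deg' using c le V(4) by auto
      show "simple_graph (insert p V) ?G"
        using simple_graph_insert_edge[OF simple_graph_mono[OF G(1)], of "insert p V" c p] cV p by auto
      show "{u, v} \<notin> ?G" using G(2) V p by (auto simp: doubleton_eq_iff)
      show "degree ?G i \<le> s" if "i \<in> insert p V" for i
        using that deg[of i] c p s degp cV unfolding deg' by (auto simp: Suc_le_eq)
    qed (use V in auto)
    then show ?thesis
      using cosh_real_pos[of \<Theta>]
      unfolding odds_sum_pendant[OF V(1-3) cV p G(1)] by (simp add: zero_le_mult_iff)
  qed
qed

section \<open>From uniform to arbitrary weights\<close>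

text \<open>
  On the two points \<open>\<plusminus>1\<close> every function is affine, which fixes the coefficients
  \<open>\<beta> = sinh J / sinh \<Theta>\<close> and \<open>\<alpha> = sinh (\<Theta> - J) / sinh \<Theta>\<close>.
\<close>

lemma exp_sign_convex:
  fixes J \<Theta> :: real
  assumes "0 \<le> J" "J \<le> \<Theta>" "0 < \<Theta>"
  obtains \<alpha> \<beta> where "\<alpha> \<ge> 0" "\<beta> \<ge> 0"
    "\<And>y. y = 1 \<or> y = -1 \<Longrightarrow> exp (J * y) = \<alpha> + \<beta> * exp (\<Theta> * y)"
proof
  define \<beta> where "\<beta> = sinh J / sinh \<Theta>"
  have sinh: "sinh \<Theta> > 0" using assms by simp
  have "sinh (\<Theta> - J) \<ge> 0" using assms by simp
  then have "sinh J * cosh \<Theta> \<le> cosh J * sinh \<Theta>" by (simp add: sinh_diff mult.commute)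
  then show "cosh J - \<beta> * cosh \<Theta> \<ge> 0" using sinh by (simp add: \<beta>_def field_simps)
  show "\<beta> \<ge> 0" using assms by (simp add: \<beta>_def)
  fix y :: real assume y: "y = 1 \<or> y = -1"
  have exp_eq: "exp (c * y) = cosh c + y * sinh c" for c :: real
    using y cosh_plus_sinh[of c] cosh_minus_sinh[of c] by (elim disjE) simp_all
  have "sinh J = \<beta> * sinh \<Theta>" using sinh by (simp add: \<beta>_def)
  then show "exp (J * y) = (cosh J - \<beta> * cosh \<Theta>) + \<beta> * exp (\<Theta> * y)"
    unfolding exp_eq by (simp add: algebra_simps)
qed

text \<open>
  The factors \<open>exp (J e * y)\<close> are replaced one edge at a time: \<open>A\<close> is the set of edges still carrying their own
  coupling, and \<open>F\<close> the set of those that have received the coupling \<open>\<Theta>\<close>. The remaining edges of \<open>G\<close> are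
  those that have been deleted.
\<close>

lemma weighted_sum_nonneg_if_uniform:
  fixes f :: "(nat \<Rightarrow> real) \<Rightarrow> real"
  assumes V: "finite V" "simple_graph V G" and J: "\<And>e. e \<in> G \<Longrightarrow> 0 \<le> J e \<and> J e \<le> \<Theta>" and \<Theta>: "\<Theta> \<ge> 0"
    and uniform: "\<And>F. F \<subseteq> G \<Longrightarrow> (\<Sum>x\<in>configs V. f x * exp (\<Theta> * (\<Sum>e\<in>F. edge_spin x e))) \<ge> 0"
  shows "(\<Sum>x\<in>configs V. f x * exp (\<Sum>e\<in>G. J e * edge_spin x e)) \<ge> 0"
proof (cases "\<Theta> = 0")
  case True
  then have "J e = 0" if "e \<in> G" for e using J that by force
  then show ?thesis using uniform[of "{}"] by simp
next
  case False
  have finG: "finite G" using simple_graph_finite V by blast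
  have "(\<Sum>x\<in>configs V. f x * exp (\<Sum>e\<in>A. J e * edge_spin x e) * exp (\<Theta> * (\<Sum>e\<in>F. edge_spin x e))) \<ge> 0"
    if "finite A" "A \<subseteq> G" "F \<subseteq> G - A" for A F
    using that
  proof (induction A arbitrary: F rule: finite_induct)
    case empty
    then show ?case using uniform[of F] by auto
  next
    case (insert e A)
    have e: "e \<in> G" "e \<notin> F" using insert.prems by auto
    have finF: "finite F" using insert.prems finG finite_subset by blast
    obtain \<alpha> \<beta> where ab: "\<alpha> \<ge> 0" "\<beta> \<ge> 0"
      "\<And>y. y = 1 \<or> y = -1 \<Longrightarrow> exp (J e * y) = \<alpha> + \<beta> * exp (\<Theta> * y)"
      using exp_sign_convex[of "J e" \<Theta>] J[OF e(1)] False \<Theta> by auto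
    let ?W = "\<lambda>F x. f x * exp (\<Sum>e\<in>A. J e * edge_spin x e) * exp (\<Theta> * (\<Sum>e\<in>F. edge_spin x e))"
    have "f x * exp (\<Sum>e\<in>insert e A. J e * edge_spin x e) * exp (\<Theta> * (\<Sum>e\<in>F. edge_spin x e))
        = \<alpha> * ?W F x + \<beta> * ?W (insert e F) x" if x: "x \<in> configs V" for x
    proof -
      have "exp (\<Sum>e\<in>insert e A. J e * edge_spin x e)
          = (\<alpha> + \<beta> * exp (\<Theta> * edge_spin x e)) * exp (\<Sum>e\<in>A. J e * edge_spin x e)"
        using insert.hyps ab(3)[OF edge_spin_config[OF x V(2) e(1)]] by (simp add: exp_add)
      moreover have "exp (\<Theta> * (\<Sum>e\<in>insert e F. edge_spin x e))
          = exp (\<Theta> * edge_spin x e) * exp (\<Theta> * (\<Sum>e\<in>F. edge_spin x e))"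
        using finF e(2) by (simp add: exp_add distrib_left)
      ultimately show ?thesis by (simp add: algebra_simps)
    qed
    then have "(\<Sum>x\<in>configs V. f x * exp (\<Sum>e\<in>insert e A. J e * edge_spin x e) * exp (\<Theta> * (\<Sum>e\<in>F. edge_spin x e)))
        = \<alpha> * (\<Sum>x\<in>configs V. ?W F x) + \<beta> * (\<Sum>x\<in>configs V. ?W (insert e F) x)"
      by (simp add: sum.distrib sum_distrib_left)
    also have "\<dots> \<ge> 0"
      using insert.prems insert.hyps ab e
      by (intro add_nonneg_nonneg mult_nonneg_nonneg insert.IH) auto
    finally show ?case .
  qed
  from this[OF finG order.refl, of "{}"] show ?thesis by simp
qed

lemma ising_sum_odds_bound:
  assumes V: "finite V" "u \<in> V" "v \<in> V" "u \<noteq> v" and G: "simple_graph V G" "{u, v} \<notin> G"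
    and deg: "\<And>i. i \<in> V \<Longrightarrow> degree G i \<le> s"
    and J: "\<And>e. e \<in> G \<Longrightarrow> 0 \<le> J e \<and> J e \<le> \<Theta>" and s: "s \<ge> 3" and \<Theta>: "\<Theta> \<ge> 0"
  shows "(\<Sum>x\<in>configs V. x u * x v * exp (\<Sum>e\<in>G. J e * edge_spin x e))
      \<le> (R s \<Theta> - 1) / (R s \<Theta> + 1) * (\<Sum>x\<in>configs V. exp (\<Sum>e\<in>G. J e * edge_spin x e))"
proof -
  let ?W = "\<lambda>x. exp (\<Sum>e\<in>G. J e * edge_spin x e)"
  have finG: "finite G" using simple_graph_finite V G by blast
  have "(\<Sum>x\<in>configs V. (R s \<Theta> - 1 - (R s \<Theta> + 1) * (x u * x v)) * ?W x) \<ge> 0"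
  proof (rule weighted_sum_nonneg_if_uniform[OF V(1) G(1) J \<Theta>])
    fix F assume F: "F \<subseteq> G"
    have "odds_sum V s \<Theta> u v F \<ge> 0"
      using V G F deg degree_mono[OF finG F] s \<Theta>
      by (intro odds_sum_nonneg simple_graph_subset[OF G(1) F]) (auto intro: order.trans)
    then show "(\<Sum>x\<in>configs V. (R s \<Theta> - 1 - (R s \<Theta> + 1) * (x u * x v)) * exp (\<Theta> * (\<Sum>e\<in>F. edge_spin x e))) \<ge> 0"
      unfolding odds_sum_def .
  qed
  also have "(\<Sum>x\<in>configs V. (R s \<Theta> - 1 - (R s \<Theta> + 1) * (x u * x v)) * ?W x)
      = (R s \<Theta> - 1) * (\<Sum>x\<in>configs V. ?W x) - (R s \<Theta> + 1) * (\<Sum>x\<in>configs V. x u * x v * ?W x)"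
    unfolding sum_distrib_left sum_subtractf[symmetric] by (intro sum.cong refl) algebra
  finally show ?thesis
    using R_pos[of s \<Theta>] by (simp add: field_simps)
qed

section \<open>The bounds on the correlation of the least correlated edge\<close>

lemma finite_vertex_pairs: "finite (vertex_pairs d)"
  by (rule finite_subset[of _ "Pow {1..d}"]) (auto simp: vertex_pairs_def)

text \<open>
  By monotonicity a witness is not a subgraph of a graph without the property, so it has an edge \<open>{u, v}\<close>
  that this graph lacks; the minimum over its edges is at most the correlation of that pair. The couplings are
  \<open>J e = \<theta> * w e\<close>.
\<close>

lemma Q_le_if_nonadjacent_correlation_le:
  fixes b :: real
  assumes "monotone_property d P" "\<theta> > 0"
    and "\<And>G J u v. simple_graph {1..d} G \<Longrightarrow> \<Theta> \<ge> 0 \<Longrightarrow> (\<And>i. i \<in> {1..d} \<Longrightarrow> degree G i \<le> s) \<Longrightarrow>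
      (\<And>e. e \<in> G \<Longrightarrow> 0 \<le> J e \<and> J e \<le> \<Theta>) \<Longrightarrow>
      u \<in> {1..d} \<Longrightarrow> v \<in> {1..d} \<Longrightarrow> u \<noteq> v \<Longrightarrow> {u, v} \<notin> G \<Longrightarrow>
      (\<Sum>x\<in>configs {1..d}. x u * x v * exp (\<Sum>e\<in>G. J e * edge_spin x e))
        \<le> b * (\<Sum>x\<in>configs {1..d}. exp (\<Sum>e\<in>G. J e * edge_spin x e))"
  shows "Q d P (restriction_set d \<theta> s \<Theta>) \<theta> \<le> ereal b"
  unfolding Q_def
proof (intro SUP_least)
  fix Gw G' assume Gw: "Gw \<in> null_graphs d P \<inter> restriction_set d \<theta> s \<Theta>" and G': "G' \<in> witnesses d P"
  obtain G w where Gw_eq: "Gw = (G, w)" by (cases Gw)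
  have G: "G \<in> graphs d" "\<not> P G" "\<And>e. e \<in> G \<Longrightarrow> w e > 0"
    and restr: "maxdeg d G \<le> s" "sup_norm d w \<le> \<Theta> / \<theta>"
    using Gw by (auto simp: Gw_eq null_graphs_def restriction_set_def weighted_graphs_def)
  have "\<not> G' \<subseteq> G"
    using assms(1) G G' unfolding monotone_property_def witnesses_def by auto
  then obtain e where e: "e \<in> G'" "e \<notin> G" by blast
  then obtain u v where uv: "u \<in> {1..d}" "v \<in> {1..d}" "u \<noteq> v" "e = {u, v}"
    using G' unfolding witnesses_def graphs_def vertex_pairs_def by blast
  have simple: "simple_graph {1..d} G"
    using G(1) unfolding simple_graph_def graphs_def vertex_pairs_def by blast
  have w: "w e \<le> \<Theta> / \<theta>" if "e \<in> G" for e
  proof -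
    have "e \<in> vertex_pairs d" using G(1) that by (auto simp: graphs_def)
    then have "\<bar>w e\<bar> \<le> sup_norm d w"
      unfolding sup_norm_def using finite_vertex_pairs by (intro Max_ge) auto
    then show ?thesis using restr by linarith
  qed
  have "0 \<le> sup_norm d w"
    unfolding sup_norm_def using finite_vertex_pairs by (intro Max_ge) auto
  then have \<Theta>: "\<Theta> \<ge> 0"
    using restr(2) assms(2) by (meson order.trans zero_le_divide_iff not_le)
  have deg: "degree G i \<le> s" if "i \<in> {1..d}" for i
  proof -
    have "degree G i \<le> maxdeg d G" unfolding maxdeg_def using that by (intro Max_ge) auto
    then show ?thesis using restr by linarith
  qed
  have J: "0 \<le> \<theta> * w e \<and> \<theta> * w e \<le> \<Theta>" if "e \<in> G" for e
    using w[OF that] G(3)[OF that] assms(2) by (simp add: pos_le_divide_eq mult.commute)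
  have weight: "ising_weight \<theta> Gw x = exp (\<Sum>e\<in>G. \<theta> * w e * edge_spin x e)" for x
    by (simp add: Gw_eq ising_weight_def sum_distrib_left mult.assoc)
  have "correlation d \<theta> Gw u v \<le> b"
    unfolding correlation_eq_sum pos_divide_le_eq[OF partition_function_pos]
    unfolding weight spins_eq_configs
    using assms(3)[OF simple \<Theta> deg J uv(1-3)] e uv(4) by simp
  then have "ereal (correlation d \<theta> Gw u v) \<le> ereal b" by simp
  moreover have "(u, v) \<in> {(u, v). {u, v} \<in> G'}" using e uv by simp
  ultimately show "(INF (u, v)\<in>{(u, v). {u, v} \<in> G'}. ereal (correlation d \<theta> Gw u v)) \<le> ereal b"
    by (intro INF_lower2[of "(u, v)"]) auto
qed

theorem proposition3p3:
  fixes d s :: nat and P :: "nat set set \<Rightarrow> bool" and \<theta> \<Theta> :: real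
  assumes "monotone_property d P"
    and "\<theta> > 0"
  shows "(s \<ge> 3 \<longrightarrow>
            Q d P (restriction_set d \<theta> s \<Theta>) \<theta> \<le> ereal ((R s \<Theta> - 1) / (R s \<Theta> + 1))) \<and>
         ((real s - 1) * tanh \<Theta> < 1 \<longrightarrow>
            Q d P (restriction_set d \<theta> s \<Theta>) \<theta>
              \<le> ereal (real s * (tanh \<Theta>)\<^sup>2 / (1 - (real s - 1) * tanh \<Theta>)))"
proof (intro conjI impI)
  assume "s \<ge> 3"
  then show "Q d P (restriction_set d \<theta> s \<Theta>) \<theta> \<le> ereal ((R s \<Theta> - 1) / (R s \<Theta> + 1))"
    by (intro Q_le_if_nonadjacent_correlation_le[OF assms] ising_sum_odds_bound) auto
next
  assume "(real s - 1) * tanh \<Theta> < 1"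
  then show "Q d P (restriction_set d \<theta> s \<Theta>) \<theta>
      \<le> ereal (real s * (tanh \<Theta>)\<^sup>2 / (1 - (real s - 1) * tanh \<Theta>))"
    by (intro Q_le_if_nonadjacent_correlation_le[OF assms] ising_sum_nonadjacent_bound) auto
qed

end
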